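(* Let a Haar-type gPC expansion be given (see context), with orthogonal matrix $\mathcal{H}$ and diagonal matrices $\mathcal{D}(\hat u)=\mathcal{H}^{T}\mathcal{P}(\hat u)\mathcal{H}$. Then the following statements are satisfied. (i) The gPC modes of the function $p(u):=u^\gamma$ for the exponent $\gamma\in\mathbb{Q}^+_0$ (non-negative rationals) and with the non-negative expansion $\Pi_K[\hat u](\xi(\omega))\in\mathbb{R}^+_0$ read as $$\hat p(\hat u)=\mathcal{H}\,\mathcal{D}(\hat u)^{\gamma}\,\mathcal{H}^{T}\hat e_1\qquad\text{with Jacobian}\qquad \mathrm{D}_{\hat u}\hat p(\hat u)=\gamma\,\mathcal{H}\,\mathcal{D}(\hat u)^{\gamma-1}\,\mathcal{H}^{T}.$$ (ii) The gPC modes for the signum function of the real-valued expansion $\Pi_K[\hat u](\xi(\omega))\in\mathbb{R}$ are $$\hat s(\hat u):=\mathcal{H}\,\operatorname{sign}\{\mathcal{D}(\hat u)\}\,\mathcal{H}^{T}\hat e_1 .$$ (iii) The gPC modes of the absolute value of the real-valued expansion $\Pi_K[\hat u](\xi(\omega))\in\mathbb{R}$ read as $$\widehat{|u|}=\hat s(\hat u)\ast\hat u\qquad\text{with Jacobian}\qquad \mathrm{D}_{\hat u}\widehat{|u|}=\mathcal{H}\,\operatorname{sign}\{\mathcal{D}(\hat u)\}\,\mathcal{H}^{T}.$$ (iv) The gPC modes of the $p$-norm for a vector-valued expansion $\Pi_K[\hat u](\xi(\omega))\in\mathbb{R}^d$ with gPC coefficients $\hat u=(\hat u_1,\dots,\hat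 u_d)^T$, $\hat u_i\in\mathbb{R}^{K+1}$, are $$\widehat{\|u\|_1}=\sum_{i=1}^d\mathcal{H}\,|\mathcal{D}(\hat u_i)|\,\mathcal{H}^{T}\hat e_1\qquad\text{and}\qquad \widehat{\|u\|_p}=\mathcal{H}\,\big|\mathcal{D}(\hat c(\hat u))\big|^{\frac1p}\,\mathcal{H}^{T}\hat e_1$$ for $$\hat c(\hat u):=\sum_{i=1}^d\widehat{|u_i|}^{\,\ast p}\qquad\text{with}\qquad \widehat{|u_i|}^{\,\ast p}=\mathcal{H}\,|\mathcal{D}(\hat u_i)|^p\,\mathcal{H}^{T}\hat e_1 .$$ The Jacobian reads as $$\mathrm{D}_{\hat u_i}\widehat{\|u\|_p}=\mathcal{H}\Big[\mathcal{D}^{\frac1p-1}\big(\hat c(\hat u)\big)\,|\mathcal{D}(\hat u_i)|^{p-1}\,\mathcal{D}\big(\hat s(\hat u_i)\big)\Big]\mathcal{H}^{T}.$$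
   Context: Haar-type expansion. Let $K\in\mathbb{N}_0$ and let $\xi\sim\mathcal{U}(0,1)$ be uniformly distributed, with law $\mathbb{P}$; write $\langle f,g\rangle_{\mathbb{P}}=\mathbb{E}[f(\xi)g(\xi)]$. Matrix and vector indices run over $0,\dots,K$. The canonical Haar matrix $A_c\in\mathbb{R}^{(K+1)\times(K+1)}$ has all entries equal to $1$ in row $0$; for $i=1,\dots,K$, row $i$ has zeros in columns $0,\dots,i-2$, the entry $h^d_i=s_ih^r_i$ in column $i-1$, and the entry $h^r_i=\sqrt{(K+1)/(s_i^2-s_i)}$ in columns $i,\dots,K$, where $s_i=-(K+1-i)$. A Haar-type matrix is $A=\begin{pmatrix}1&0\\0&O\end{pmatrix}A_c$ with an orthogonal matrix $O\in\mathbb{R}^{K\times K}$; it satisfies $AA^T=(K+1)I$. Its basis functions are $\phi_k(\xi)=\sum_{\ell=0}^K A_{k\ell}\,\chi_{[0,1]}((K+1)\xi-\ell)$, $k=0,\dots,K$, where $\chi_{[0,1]}$ is the indicator function of $[0,1]$; they are orthonormal in $L^2(\mathbb{P})$. Put $\mathcal{H}:=A/\sqrt{K+1}$, an orthogonal matrix. For $\hat u\in\mathbb{R}^{K+1}$ let $\Pi_K[\hat u](\xi)=\sum_{k=0}^K\hat u_k\phi_k(\xi)$ (applied componentwise for vector-valued expansions). The stochastic Galerkin matrix is $\mathcal{P}(\hat u)=\sum_{k=0}^K\hat u_k\mathcal{M}_k$ with $\mathcal{M}_k=(\langle\phi_k,\phi_i\phi_j\rangle_{\mathbb{P}})_{i,j=0,\dots,K}$,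 the Galerkin product is $\hat u\ast\hat q=\mathcal{P}(\hat u)\hat q$, and $\hat u^{\ast m}=\mathcal{P}(\hat u)^m\hat e_1$ with $\hat e_1=(1,0,\dots,0)^T\in\mathbb{R}^{K+1}$. For Haar-type expansions $\mathcal{P}(\hat u)=\mathcal{H}\mathcal{D}(\hat u)\mathcal{H}^T$ with $\mathcal{D}(\hat u)$ a diagonal matrix of eigenvalues. gPC modes. gPC modes of a random quantity $g(\xi)\in L^2$ are coefficients $\hat g\in\mathbb{R}^{K+1}$ whose truncated series satisfies $\|\Pi_K[\hat g]-g\|_{L^2(\mathbb{P})}\to0$ as $K\to\infty$. Modes of nonlinear functions of a random quantity with modes $\hat u$ are built from $\hat u$ by Galerkin operations: products are represented by the Galerkin product, $m$-th powers by $\mathcal{T}_m(\hat u)=\hat u^{\ast m}$, and $n$-th roots by the inverse of the bijection $\mathcal{T}_n:\mathbb{H}^+_0\to\mathbb{H}^+_0$, where $\mathbb{H}^+_0$ is the set of $\hat u\in\mathbb{R}^{K+1}$ with $\mathcal{P}(\hat u)$ positive semidefinite. Powers, absolute values and signs of diagonal matrices are taken entrywise on the diagonal. $\mathrm{D}_{\hat u}$ denotes the Jacobian with respect to $\hat u$.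
   Formalization: Jacobians are claimed only where they exist (relevant eigenvalues nonzero); in the limit K→∞, powers γ>1 also assume the limit's γ-th power is in L² and convergence in L^{2γ}, and the signum assumes a limit nonzero almost surely; the identities at fixed K are unconditional. *)

theory Defs
  imports "HOL-Probability.Probability" "Jordan_Normal_Form.Matrix"
begin

unbundle no vec_syntax
unbundle no inner_syntax

definition orthonormal_mat :: "nat \<Rightarrow> real mat \<Rightarrow> bool" where
  "orthonormal_mat n Q \<longleftrightarrow> Q \<in> carrier_mat n n \<and> Q * transpose_mat Q = 1\<^sub>m n
     \<and> transpose_mat Q * Q = 1\<^sub>m n"

definition haar_s :: "nat \<Rightarrow> nat \<Rightarrow> real" where
  "haar_s K i = - (real K + 1 - real i)"

definition haar_r :: "nat \<Rightarrow> nat \<Rightarrow> real" where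
  "haar_r K i = sqrt ((real K + 1) / ((haar_s K i)^2 - haar_s K i))"

definition haar_d :: "nat \<Rightarrow> nat \<Rightarrow> real" where
  "haar_d K i = haar_s K i * haar_r K i"

definition haar_canonical :: "nat \<Rightarrow> real mat" where
  "haar_canonical K = Matrix.mat (K + 1) (K + 1) (\<lambda>(i, j).
     if i = 0 then 1
     else if j + 1 < i then 0
     else if j + 1 = i then haar_d K i
     else haar_r K i)"

definition haar_type :: "nat \<Rightarrow> real mat \<Rightarrow> real mat" where
  "haar_type K Q = four_block_mat (1\<^sub>m 1) (0\<^sub>m 1 K) (0\<^sub>m K 1) Q * haar_canonical K"

definition unif01 :: "real measure" where
  "unif01 = uniform_measure lborel {0<..<1}"

definition inner_P :: "(real \<Rightarrow> real) \<Rightarrow> (real \<Rightarrow> real) \<Rightarrow> real" where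
  "inner_P f g = (LINT x|unif01. f x * g x)"

definition norm_P :: "(real \<Rightarrow> real) \<Rightarrow> real" where
  "norm_P f = sqrt (inner_P f f)"

text \<open>Below, \<open>A\<close> is a Haar-type matrix of size \<open>K + 1\<close>; the number \<open>K + 1\<close> is recovered as
  \<open>dim_row A\<close>.\<close>

definition basis_fun :: "real mat \<Rightarrow> nat \<Rightarrow> real \<Rightarrow> real" where
  "basis_fun A k x =
     (\<Sum>l<dim_col A. A $$ (k, l) * indicator {0..1} (real (dim_col A) * x - real l))"

definition expansion :: "real mat \<Rightarrow> real vec \<Rightarrow> real \<Rightarrow> real" where
  "expansion A u x = (\<Sum>k<dim_row A. u $ k * basis_fun A k x)"

definition galerkin_M :: "real mat \<Rightarrow> nat \<Rightarrow> real mat" where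
  "galerkin_M A k = Matrix.mat (dim_row A) (dim_row A)
     (\<lambda>(i, j). inner_P (basis_fun A k) (\<lambda>x. basis_fun A i x * basis_fun A j x))"

definition galerkin_P :: "real mat \<Rightarrow> real vec \<Rightarrow> real mat" where
  "galerkin_P A u = Matrix.mat (dim_row A) (dim_row A)
     (\<lambda>(i, j). \<Sum>k<dim_row A. u $ k * galerkin_M A k $$ (i, j))"

definition galerkin_prod :: "real mat \<Rightarrow> real vec \<Rightarrow> real vec \<Rightarrow> real vec" where
  "galerkin_prod A u q = galerkin_P A u *\<^sub>v q"

definition e1_vec :: "real mat \<Rightarrow> real vec" where
  "e1_vec A = unit_vec (dim_row A) 0"

definition galerkin_power :: "real mat \<Rightarrow> nat \<Rightarrow> real vec \<Rightarrow> real vec" where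
  "galerkin_power A m u = (galerkin_P A u ^\<^sub>m m) *\<^sub>v e1_vec A"

definition pos_semidef :: "nat \<Rightarrow> real mat \<Rightarrow> bool" where
  "pos_semidef n B \<longleftrightarrow> B \<in> carrier_mat n n \<and> transpose_mat B = B
     \<and> (\<forall>x\<in>carrier_vec n. 0 \<le> scalar_prod x (B *\<^sub>v x))"

definition psd_modes :: "real mat \<Rightarrow> real vec set" where
  "psd_modes A = {u \<in> carrier_vec (dim_row A). pos_semidef (dim_row A) (galerkin_P A u)}"

definition galerkin_root :: "real mat \<Rightarrow> nat \<Rightarrow> real vec \<Rightarrow> real vec" where
  "galerkin_root A n = the_inv_into (psd_modes A) (galerkin_power A n)"

definition haar_H :: "real mat \<Rightarrow> real mat" where
  "haar_H A = (1 / sqrt (real (dim_row A))) \<cdot>\<^sub>m A"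

definition haar_D :: "real mat \<Rightarrow> real vec \<Rightarrow> real mat" where
  "haar_D A u = transpose_mat (haar_H A) * galerkin_P A u * haar_H A"

definition diag_fun :: "(real \<Rightarrow> real) \<Rightarrow> real mat \<Rightarrow> real mat" where
  "diag_fun f B = mat_diag (dim_row B) (\<lambda>i. f (B $$ (i, i)))"

text \<open>Real powers with \<open>0\<^sup>0 = 1\<close>, whereas \<open>0 powr 0 = 0\<close>.\<close>

definition rpow :: "real \<Rightarrow> real \<Rightarrow> real" where
  "rpow x a = (if a = 0 then 1 else x powr a)"

definition modes_pow :: "real mat \<Rightarrow> real \<Rightarrow> real vec \<Rightarrow> real vec" where
  "modes_pow A \<gamma> u =
     (haar_H A * diag_fun (\<lambda>x. rpow x \<gamma>) (haar_D A u) * transpose_mat (haar_H A)) *\<^sub>v e1_vec A"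

definition modes_sign :: "real mat \<Rightarrow> real vec \<Rightarrow> real vec" where
  "modes_sign A u =
     (haar_H A * diag_fun sgn (haar_D A u) * transpose_mat (haar_H A)) *\<^sub>v e1_vec A"

definition modes_abs :: "real mat \<Rightarrow> real vec \<Rightarrow> real vec" where
  "modes_abs A u = galerkin_prod A (modes_sign A u) u"

definition modes_abs_pow :: "real mat \<Rightarrow> real \<Rightarrow> real vec \<Rightarrow> real vec" where
  "modes_abs_pow A p u =
     (haar_H A * diag_fun (\<lambda>x. rpow \<bar>x\<bar> p) (haar_D A u) * transpose_mat (haar_H A)) *\<^sub>v e1_vec A"

definition sum_modes :: "real mat \<Rightarrow> nat \<Rightarrow> (nat \<Rightarrow> real vec) \<Rightarrow> real vec" where
  "sum_modes A d f = Matrix.vec (dim_row A) (\<lambda>k. \<Sum>i=1..d. f i $ k)"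

definition modes_norm1 :: "real mat \<Rightarrow> nat \<Rightarrow> (nat \<Rightarrow> real vec) \<Rightarrow> real vec" where
  "modes_norm1 A d us = sum_modes A d (\<lambda>i.
     (haar_H A * diag_fun abs (haar_D A (us i)) * transpose_mat (haar_H A)) *\<^sub>v e1_vec A)"

definition modes_c :: "real mat \<Rightarrow> real \<Rightarrow> nat \<Rightarrow> (nat \<Rightarrow> real vec) \<Rightarrow> real vec" where
  "modes_c A p d us = sum_modes A d (\<lambda>i. modes_abs_pow A p (us i))"

definition modes_norm :: "real mat \<Rightarrow> real \<Rightarrow> nat \<Rightarrow> (nat \<Rightarrow> real vec) \<Rightarrow> real vec" where
  "modes_norm A p d us =
     (haar_H A * diag_fun (\<lambda>x. rpow \<bar>x\<bar> (1 / p)) (haar_D A (modes_c A p d us))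
        * transpose_mat (haar_H A)) *\<^sub>v e1_vec A"

definition pnorm :: "real \<Rightarrow> nat \<Rightarrow> (nat \<Rightarrow> real) \<Rightarrow> real" where
  "pnorm p d a = (\<Sum>i=1..d. \<bar>a i\<bar> powr p) powr (1 / p)"

text \<open>Coefficients of a random quantity: one coefficient vector for every truncation index
  \<open>k\<close>, each relative to its own Haar-type matrix, given by the orthogonal matrix \<open>Q k\<close>.\<close>

definition gpc_modes :: "(nat \<Rightarrow> real mat) \<Rightarrow> (nat \<Rightarrow> real vec) \<Rightarrow> (real \<Rightarrow> real) \<Rightarrow> bool" where
  "gpc_modes Q c g \<longleftrightarrow> g \<in> borel_measurable borel \<and> integrable unif01 (\<lambda>x. (g x)^2)
     \<and> (\<forall>k. c k \<in> carrier_vec (k + 1))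
     \<and> (\<lambda>k. norm_P (\<lambda>x. expansion (haar_type k (Q k)) (c k) x - g x)) \<longlonglongrightarrow> 0"

definition vnorm :: "real vec \<Rightarrow> real" where
  "vnorm v = sqrt (scalar_prod v v)"

text \<open>\<open>J\<close> is the matrix of the total derivative of \<open>F\<close> at \<open>u\<close> within \<open>S\<close>. The type of vectors
  used here carries no topology, so the definition spells out \<open>has_derivative_within_alt\<close>.\<close>

definition has_jacobian ::
  "(real vec \<Rightarrow> real vec) \<Rightarrow> real mat \<Rightarrow> real vec set \<Rightarrow> real vec \<Rightarrow> bool" where
  "has_jacobian F J S u \<longleftrightarrow> (\<forall>\<epsilon>>0. \<exists>\<delta>>0. \<forall>v\<in>S. vnorm (v - u) < \<delta> \<longrightarrow>
     vnorm (F v - F u - J *\<^sub>v (v - u)) \<le> \<epsilon> * vnorm (v - u))"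

end

theory Submission
  imports Defs "Jordan_Normal_Form.Determinant"
begin

text \<open>Up to a null set, an expansion with coefficients \<open>u\<close> is a step function on the \<open>K + 1\<close> cells
  \<open>(l / (K + 1), (l + 1) / (K + 1))\<close>, with values \<open>A\<^sup>T u\<close>. These cell values are exactly the
  eigenvalues on the diagonal of \<open>haar_D A u\<close>, and \<open>e1_vec A\<close> has all cell values \<open>1\<close>. In these
  coordinates every Galerkin operation therefore acts entrywise: products, powers, roots and signs
  of modes become those of the cell values, the expansion of the modes of \<open>f(u)\<close> equals \<open>f\<close> of the
  expansion of \<open>u\<close> almost everywhere, and Jacobians are diagonal. Convergence of the modes then
  reduces to continuity of superposition operators on \<open>L\<^sup>2\<close>: absolute values and \<open>p\<close>-norms are
  Lipschitz, while for signs and powers the squared error is at most a function of arbitrarily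
  small integral plus a constant multiple of an error that is known to vanish in the limit.\<close>

section \<open>Cell values and modes\<close>

text \<open>The Haar structure is used through the facts collected in \<open>haar_matrix\<close>:
  orthogonality of rows and of columns makes passing to cell values invertible, and the constant row
  0 turns the first unit vector into the constant function 1. Nothing relates the matrices
  \<open>Q k\<close> at different levels, so only expansions, never coefficients, are compared with
  the limit \<open>g\<close>. The limit statements are shaped by the mode of convergence: it holds
  in mean square, so each nonlinear map \<open>f\<close> needs a scalar inequality valid for all
  arguments, of the form \<open>(f a - f b)^2 <= w b + C * q (a - b)\<close>. The sign is
  discontinuous at 0: there \<open>w\<close> is 4 times the indicator of a neighbourhood of 0, and
  its integral along \<open>g\<close> is small because \<open>g\<close> is nonzero almost
  everywhere. Powers are in general neither Lipschitz nor bounded: scaling by \<open>b\<close>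
  reduces them to continuity of \<open>t powr \<gamma>\<close> at 1 and leads to the error
  \<open>q t = \<bar>t\<bar> powr (2 * \<gamma>)\<close>. Mean-square convergence controls this
  error for \<open>\<gamma> \<le> 1\<close>; for \<open>\<gamma> > 1\<close> its convergence is a
  hypothesis.\<close>

definition cell_val :: "real mat \<Rightarrow> real vec \<Rightarrow> nat \<Rightarrow> real" where
  "cell_val A u l = (\<Sum>k<dim_row A. u $ k * A $$ (k, l))"

locale haar_matrix =
  fixes A :: "real mat" and n :: nat
  assumes carrier: "A \<in> carrier_mat n n"
    and pos: "0 < n"
    and row_orth: "A * transpose_mat A = real n \<cdot>\<^sub>m 1\<^sub>m n"
    and col_orth: "transpose_mat A * A = real n \<cdot>\<^sub>m 1\<^sub>m n"
    and row0: "\<And>l. l < n \<Longrightarrow> A $$ (0, l) = 1"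
begin

lemma dims [simp]: "dim_row A = n" "dim_col A = n"
  using carrier by auto

lemma row_orth': "i < n \<Longrightarrow> j < n \<Longrightarrow>
    (\<Sum>l<n. A $$ (i, l) * A $$ (j, l)) = (if i = j then real n else 0)"
  using arg_cong[OF row_orth, of "\<lambda>B. B $$ (i, j)"]
  by (simp add: scalar_prod_def lessThan_atLeast0 split: if_splits)

lemma col_orth': "i < n \<Longrightarrow> j < n \<Longrightarrow>
    (\<Sum>k<n. A $$ (k, i) * A $$ (k, j)) = (if i = j then real n else 0)"
  using arg_cong[OF col_orth, of "\<lambda>B. B $$ (i, j)"]
  by (simp add: scalar_prod_def lessThan_atLeast0 split: if_splits)

text \<open>The inverse of passing to cell values: because the rows of \<open>A\<close> are
  orthogonal with squared length \<open>n\<close>, the inverse of the transpose of \<open>A\<close>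
  is \<open>A / n\<close>.\<close>

definition modes_of :: "(nat \<Rightarrow> real) \<Rightarrow> real vec" where
  "modes_of f = Matrix.vec n (\<lambda>k. (\<Sum>l<n. A $$ (k, l) * f l) / real n)"

lemma modes_of_carrier [simp]: "modes_of f \<in> carrier_vec n"
  by (simp add: modes_of_def)

lemma cell_val_modes_of [simp]:
  assumes "l < n" shows "cell_val A (modes_of f) l = f l"
proof -
  have "cell_val A (modes_of f) l = (\<Sum>k<n. \<Sum>j<n. A $$ (k, j) * A $$ (k, l) * f j) / real n"
    by (simp add: cell_val_def modes_of_def sum_distrib_right sum_distrib_left sum_divide_distrib algebra_simps)
  also have "\<dots> = (\<Sum>j<n. (\<Sum>k<n. A $$ (k, j) * A $$ (k, l)) * f j) / real n"
    by (subst sum.swap) (simp add: sum_distrib_right)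
  also have "\<dots> = (\<Sum>j<n. if j = l then real n * f j else 0) / real n"
    using assms by (intro arg_cong2[where f="(/)"] sum.cong) (auto simp: col_orth')
  finally show ?thesis using assms pos by simp
qed

lemma modes_of_cell_val:
  assumes "u \<in> carrier_vec n" shows "modes_of (cell_val A u) = u"
proof (rule eq_vecI)
  fix i assume "i < dim_vec u"
  then have i: "i < n" using assms by auto
  have "(\<Sum>l<n. A $$ (i, l) * cell_val A u l) = (\<Sum>l<n. \<Sum>k<n. u $ k * (A $$ (k, l) * A $$ (i, l)))"
    by (simp add: cell_val_def sum_distrib_left algebra_simps)
  also have "\<dots> = (\<Sum>k<n. u $ k * (\<Sum>l<n. A $$ (k, l) * A $$ (i, l)))"
    by (subst sum.swap) (simp add: sum_distrib_left)
  also have "\<dots> = (\<Sum>k<n. if k = i then u $ k * real n else 0)"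
    using i by (intro sum.cong) (auto simp: row_orth')
  finally show "modes_of (cell_val A u) $ i = u $ i"
    using i pos by (simp add: modes_of_def)
qed (use assms in \<open>auto simp: modes_of_def\<close>)

lemma modes_of_cong: "(\<And>l. l < n \<Longrightarrow> f l = g l) \<Longrightarrow> modes_of f = modes_of g"
  by (simp add: modes_of_def)

lemma modes_eqI:
  assumes "u \<in> carrier_vec n" "v \<in> carrier_vec n" "\<And>l. l < n \<Longrightarrow> cell_val A u l = cell_val A v l"
  shows "u = v"
  using assms modes_of_cong[of "cell_val A u" "cell_val A v"] by (simp add: modes_of_cell_val)

lemma cell_val_minus:
  "u \<in> carrier_vec n \<Longrightarrow> v \<in> carrier_vec n \<Longrightarrow> cell_val A (u - v) l = cell_val A u l - cell_val A v l"
  by (simp add: cell_val_def algebra_simps sum_subtractf)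

text \<open>The transpose of \<open>A\<close> is \<open>sqrt n\<close> times an isometry. In the
  double sum \<open>A\<close> is moved onto the second factor, where
  \<open>modes_of_cell_val\<close> gives back \<open>u\<close>.\<close>

lemma cell_val_vnorm:
  assumes "u \<in> carrier_vec n"
  shows "(\<Sum>l<n. (cell_val A u l)\<^sup>2) = real n * (vnorm u)\<^sup>2"
proof -
  have "(\<Sum>l<n. (cell_val A u l)\<^sup>2) = (\<Sum>l<n. \<Sum>k<n. u $ k * (A $$ (k, l) * cell_val A u l))"
    by (simp add: power2_eq_square sum_distrib_right cell_val_def[of A u] mult.assoc)
  also have "\<dots> = (\<Sum>k<n. u $ k * (\<Sum>l<n. A $$ (k, l) * cell_val A u l))"
    by (subst sum.swap) (simp add: sum_distrib_left)
  also have "\<dots> = (\<Sum>k<n. u $ k * (real n * modes_of (cell_val A u) $ k))"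
    using pos by (simp add: modes_of_def)
  also have "\<dots> = real n * (\<Sum>k<n. u $ k * u $ k)"
    by (simp add: modes_of_cell_val[OF assms] sum_distrib_left algebra_simps)
  also have "(\<Sum>k<n. u $ k * u $ k) = (vnorm u)\<^sup>2"
    using assms by (simp add: vnorm_def scalar_prod_def lessThan_atLeast0 sum_nonneg)
  finally show ?thesis .
qed

text \<open>The common form of the Galerkin matrices, of the matrices that produce the modes, and of
  the Jacobians; identities between them become identities between diagonals
  \<open>f\<close>.\<close>

definition conj_diag :: "(nat \<Rightarrow> real) \<Rightarrow> real mat" where
  "conj_diag f = haar_H A * mat_diag n f * transpose_mat (haar_H A)"

lemma haar_H_carrier [simp]: "haar_H A \<in> carrier_mat n n"
  using carrier by (simp add: haar_H_def)

lemma conj_diag_carrier [simp]: "conj_diag f \<in> carrier_mat n n"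
  unfolding conj_diag_def by (intro mult_carrier_mat[of _ n n]) auto

lemma conj_diag_dims [simp]: "dim_row (conj_diag f) = n" "dim_col (conj_diag f) = n"
  using conj_diag_carrier[of f] by (auto simp del: conj_diag_carrier)

lemma conj_diag_index:
  assumes "i < n" "j < n"
  shows "conj_diag f $$ (i, j) = (\<Sum>l<n. A $$ (i, l) * f l * A $$ (j, l)) / real n"
proof -
  have eq: "haar_H A * mat_diag n f = Matrix.mat n n (\<lambda>(i,j). haar_H A $$ (i, j) * f j)"
    by (rule mat_diag_mult_right) simp
  have "conj_diag f $$ (i, j) = (\<Sum>l<n. haar_H A $$ (i, l) * f l * haar_H A $$ (j, l))"
    using assms carrier_matD[OF haar_H_carrier] unfolding conj_diag_def eq
    by (simp add: scalar_prod_def lessThan_atLeast0)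
  also have "\<dots> = (\<Sum>l<n. A $$ (i, l) * f l * A $$ (j, l) / real n)"
  proof (intro sum.cong refl)
    fix l assume "l \<in> {..<n}"
    moreover have "(1 / sqrt (real n)) * (1 / sqrt (real n)) = 1 / real n"
      by simp
    ultimately show "haar_H A $$ (i, l) * f l * haar_H A $$ (j, l) = A $$ (i, l) * f l * A $$ (j, l) / real n"
      using assms by (simp add: haar_H_def)
  qed
  finally show ?thesis by (simp add: sum_divide_distrib)
qed

text \<open>The transpose of \<open>haar_H A\<close> sends \<open>v\<close> to its cell values
  divided by \<open>sqrt n\<close>, and \<open>haar_H A\<close> leads back to modes, so the
  conjugated diagonal matrix multiplies cell values by \<open>f\<close>.\<close>

lemma conj_diag_mult_vec:
  assumes "v \<in> carrier_vec n"
  shows "conj_diag f *\<^sub>v v = modes_of (\<lambda>l. f l * cell_val A v l)"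
proof (rule eq_vecI)
  fix i assume "i < dim_vec (modes_of (\<lambda>l. f l * cell_val A v l))"
  then have i: "i < n" by (simp add: modes_of_def)
  have "(conj_diag f *\<^sub>v v) $ i = (\<Sum>j<n. conj_diag f $$ (i, j) * v $ j)"
    using assms i by (auto simp: scalar_prod_def lessThan_atLeast0)
  also have "\<dots> = (\<Sum>j<n. \<Sum>l<n. A $$ (i, l) * (f l * (v $ j * A $$ (j, l)))) / real n"
    using i by (simp add: conj_diag_index sum_distrib_right sum_distrib_left sum_divide_distrib algebra_simps)
  also have "\<dots> = (\<Sum>l<n. A $$ (i, l) * (f l * cell_val A v l)) / real n"
    by (subst sum.swap) (simp add: cell_val_def sum_distrib_left)
  finally show "(conj_diag f *\<^sub>v v) $ i = modes_of (\<lambda>l. f l * cell_val A v l) $ i"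
    using i by (simp add: modes_of_def)
qed (simp add: modes_of_def)

lemma haar_H_orth: "transpose_mat (haar_H A) * haar_H A = 1\<^sub>m n"
proof (rule eq_matI)
  fix i j assume "i < dim_row (1\<^sub>m n :: real mat)" "j < dim_col (1\<^sub>m n :: real mat)"
  then have ij: "i < n" "j < n" by auto
  have sq: "(1 / sqrt (real n)) * ((1 / sqrt (real n)) * x) = x / real n" for x
    by simp
  have "(transpose_mat (haar_H A) * haar_H A) $$ (i, j) = (\<Sum>k<n. A $$ (k, i) * A $$ (k, j)) / real n"
    using ij by (simp add: haar_H_def scalar_prod_def lessThan_atLeast0 sum_divide_distrib)
  then show "(transpose_mat (haar_H A) * haar_H A) $$ (i, j) = 1\<^sub>m n $$ (i, j)"
    using ij pos by (simp add: col_orth')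
qed (auto simp: haar_H_def)

lemma haar_H_conj_diag:
  "transpose_mat (haar_H A) * conj_diag f * haar_H A = mat_diag n f"
proof -
  let ?H = "haar_H A" and ?T = "transpose_mat (haar_H A)" and ?D = "mat_diag n f"
  have c: "?H \<in> carrier_mat n n" "?T \<in> carrier_mat n n" "?D \<in> carrier_mat n n"
    by auto
  have "?T * conj_diag f = (?T * ?H) * (?D * ?T)"
    unfolding conj_diag_def using c
    by (smt (verit) assoc_mult_mat mult_carrier_mat)
  also have "\<dots> = ?D * ?T"
    using c by (simp add: haar_H_orth left_mult_one_mat[of _ n n] mult_carrier_mat[of _ n n _ n])
  finally have "?T * conj_diag f * ?H = ?D * (?T * ?H)"
    using c by (simp add: assoc_mult_mat[of _ n n _ n _ n])
  also have "\<dots> = ?D" using c by (simp add: haar_H_orth right_mult_one_mat[of _ n n])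
  finally show ?thesis .
qed

lemma e1_carrier [simp]: "e1_vec A \<in> carrier_vec n"
  by (simp add: e1_vec_def)

lemma cell_val_e1 [simp]:
  assumes "l < n" shows "cell_val A (e1_vec A) l = 1"
proof -
  have "cell_val A (e1_vec A) l = (\<Sum>k<n. if k = 0 then A $$ (0, l) else 0)"
    unfolding cell_val_def by (intro sum.cong) (auto simp: e1_vec_def unit_vec_def)
  then show ?thesis using assms pos by (simp add: row0)
qed

lemma conj_diag_e1: "conj_diag f *\<^sub>v e1_vec A = modes_of f"
  by (simp add: conj_diag_mult_vec cong: modes_of_cong)

end

section \<open>Galerkin operations in cell values\<close>

text \<open>Index of the half-open cell of length \<open>1 / n\<close> containing \<open>x\<close>.
  Outside the unit interval, and at 1 where the value is the invalid index \<open>n\<close>, its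
  value is irrelevant, since these points are null for \<open>unif01\<close>.\<close>

definition cell :: "nat \<Rightarrow> real \<Rightarrow> nat" where
  "cell n x = nat \<lfloor>real n * x\<rfloor>"

lemma cell_measurable [measurable]: "cell n \<in> borel \<rightarrow>\<^sub>M count_space UNIV"
  unfolding cell_def by measurable

lemma sets_unif01 [simp, measurable_cong]: "sets unif01 = sets borel"
  by (simp add: unif01_def)

lemma space_unif01 [simp]: "space unif01 = UNIV"
  by (simp add: unif01_def)

interpretation unif01: prob_space unif01
  unfolding unif01_def by (rule prob_space_uniform_measure) auto

lemma cell_eqI:
  assumes "0 < n" "real l / real n \<le> x" "x < (real l + 1) / real n"
  shows "cell n x = l"
  using assms by (auto simp: cell_def field_simps nat_eq_iff floor_eq_iff)

lemma measure_unif01: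
  assumes "0 \<le> a" "a \<le> b" "b \<le> 1" shows "measure unif01 {a<..<b} = b - a"
proof -
  have "{0<..<1} \<inter> {a<..<b} = {a<..<b}" using assms by auto
  then show ?thesis using assms by (simp add: unif01_def)
qed

text \<open>The strict bounds are essential: the basis functions are built from closed cells, which
  overlap at the grid points \<open>j / n\<close>. Off these finitely many points exactly one
  indicator equals 1.\<close>

lemma AE_unif01_cell:
  assumes n: "0 < n"
  shows "AE x in unif01. cell n x < n \<and> real (cell n x) / real n < x \<and> x < (real (cell n x) + 1) / real n"
  unfolding unif01_def
proof (rule AE_uniform_measureI)
  have "AE x in lborel. x \<notin> (\<lambda>j. real j / real n) ` {..n}"
    by (intro AE_not_in finite_imp_null_set_lborel) simp
  moreover have "x \<in> {0<..<1} \<longrightarrow> cell n x < n \<and> real (cell n x) / real n < x \<and> x < (real (cell n x) + 1) / real n"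
    if "x \<notin> (\<lambda>j. real j / real n) ` {..n}" for x
  proof
    assume x: "x \<in> {0<..<1}"
    have fl: "0 \<le> \<lfloor>real n * x\<rfloor>" using x by auto
    have "real_of_int \<lfloor>real n * x\<rfloor> \<le> real n * x" by simp
    also have "\<dots> < real n" using x n by simp
    finally have lt: "cell n x < n" using fl by (simp add: cell_def nat_less_iff)
    have rc: "real (cell n x) = real_of_int \<lfloor>real n * x\<rfloor>" using fl by (simp add: cell_def)
    have "real (cell n x) \<le> real n * x" "real n * x < real (cell n x) + 1"
      unfolding rc by linarith+
    moreover have "real (cell n x) / real n \<noteq> x" using that lt by (metis atMost_iff imageI less_imp_le_nat)
    ultimately show "cell n x < n \<and> real (cell n x) / real n < x \<and> x < (real (cell n x) + 1) / real n"
      using lt n by (auto simp: field_simps)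
  qed
  ultimately show "AE x in lborel. x \<in> {0<..<1} \<longrightarrow> cell n x < n \<and> real (cell n x) / real n < x
      \<and> x < (real (cell n x) + 1) / real n"
    by (auto elim: eventually_mono)
qed simp

text \<open>Each open cell has mass \<open>1 / n > 0\<close>, so \<open>P\<close> cannot fail on a
  whole cell and still hold almost surely. This is how an almost surely nonnegative expansion yields
  nonnegative eigenvalues.\<close>

lemma AE_cell_iff:
  assumes "0 < n" shows "(AE x in unif01. P (cell n x)) \<longleftrightarrow> (\<forall>l<n. P l)"
proof
  assume *: "AE x in unif01. P (cell n x)"
  show "\<forall>l<n. P l"
  proof (intro allI impI)
    fix l assume l: "l < n"
    show "P l"
    proof (rule ccontr)
      assume "\<not> P l"
      let ?I = "{real l / real n<..<(real l + 1) / real n}"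
      have "AE x in unif01. x \<notin> ?I"
        using * by eventually_elim (use \<open>\<not> P l\<close> cell_eqI[OF assms, of l] in auto)
      then have "measure unif01 ?I = 0"
        by (subst unif01.prob_eq_0) auto
      moreover have "measure unif01 ?I = (real l + 1) / real n - real l / real n"
        using l by (intro measure_unif01) (auto simp: divide_simps)
      ultimately show False using assms by (auto simp: field_simps)
    qed
  qed
next
  assume "\<forall>l<n. P l"
  then show "AE x in unif01. P (cell n x)"
    using AE_unif01_cell[OF assms] by (auto elim: eventually_mono)
qed

lemma integral_cell:
  assumes n: "0 < n" shows "(LINT x|unif01. f (cell n x)) = (\<Sum>l<n. f l) / real n"
proof -
  let ?I = "\<lambda>l. {real l / real n<..<(real l + 1) / real n}"
  have "AE x in unif01. f (cell n x) = (\<Sum>l<n. f l * indicator (?I l) x)"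
    using AE_unif01_cell[OF n]
  proof eventually_elim
    case (elim x)
    have "x \<in> ?I l \<longleftrightarrow> l = cell n x" for l
      using elim cell_eqI[OF n, of l x] by (metis greaterThanLessThan_iff less_imp_le)
    then have "(\<Sum>l<n. f l * indicator (?I l) x) = (\<Sum>l<n. if l = cell n x then f l else 0)"
      by (intro sum.cong refl) (simp add: indicator_def del: greaterThanLessThan_iff)
    also have "\<dots> = f (cell n x)" using elim by simp
    finally show ?case by (rule sym)
  qed
  then have "(LINT x|unif01. f (cell n x)) = (LINT x|unif01. (\<Sum>l<n. f l * indicator (?I l) x))"
    by (rule integral_cong_AE[rotated 2]) measurable
  also have "\<dots> = (\<Sum>l<n. f l * measure unif01 (?I l))"
    by (subst Bochner_Integration.integral_sum) (auto simp: less_top[symmetric])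
  also have "\<dots> = (\<Sum>l<n. f l / real n)"
  proof (intro sum.cong refl)
    fix l assume "l \<in> {..<n}"
    then have "measure unif01 (?I l) = (real l + 1) / real n - real l / real n"
      by (intro measure_unif01) (auto simp: divide_simps)
    also have "\<dots> = 1 / real n" by (simp only: diff_divide_distrib[symmetric]) simp
    finally show "f l * measure unif01 (?I l) = f l / real n" by simp
  qed
  finally show ?thesis by (simp add: sum_divide_distrib)
qed

lemma basis_fun_measurable [measurable]: "basis_fun B k \<in> borel_measurable borel"
  unfolding basis_fun_def by measurable

lemma expansion_measurable [measurable]: "expansion B u \<in> borel_measurable borel"
  unfolding expansion_def by measurable

section \<open>Galerkin matrices and mode maps on cell values\<close>

context haar_matrix
begin

lemma AE_basis_fun:
  "AE x in unif01. cell n x < n \<and> (\<forall>k. basis_fun A k x = A $$ (k, cell n x))"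
  using AE_unif01_cell[OF pos]
proof eventually_elim
  case (elim x)
  have "indicator {0..1} (real n * x - real l) = (if l = cell n x then 1 else 0 :: real)" for l
  proof -
    have "real (cell n x) < real n * x" "real n * x < real (cell n x) + 1"
      using elim pos by (auto simp: field_simps)
    then show ?thesis by (cases l "cell n x" rule: linorder_cases) (auto simp: indicator_def)
  qed
  then have "basis_fun A k x = (\<Sum>l<n. if l = cell n x then A $$ (k, l) else 0)" for k
    unfolding basis_fun_def dims by (intro sum.cong) auto
  then show ?case using elim by simp
qed

text \<open>The quantifier over \<open>u\<close> stands inside the almost-everywhere statement: the
  exceptional null set depends on the cells alone and so serves whole families of coefficient
  vectors at once.\<close>

lemma AE_expansion:
  "AE x in unif01. cell n x < n \<and> (\<forall>u. expansion A u x = cell_val A u (cell n x))"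
  using AE_basis_fun by eventually_elim (auto simp: expansion_def cell_val_def)

text \<open>The integral of a product of three basis functions is the average over the cells of the
  products of matrix entries. Summing over \<open>k\<close> with weights \<open>u $ k\<close>
  collects the first factor into the cell value of \<open>u\<close>.\<close>

lemma galerkin_P_eq: "galerkin_P A u = conj_diag (cell_val A u)"
proof (rule eq_matI)
  fix i j assume "i < dim_row (conj_diag (cell_val A u))" "j < dim_col (conj_diag (cell_val A u))"
  then have ij: "i < n" "j < n" by auto
  have M: "galerkin_M A k $$ (i, j) = (\<Sum>l<n. A $$ (k, l) * (A $$ (i, l) * A $$ (j, l))) / real n" for k
  proof -
    have "galerkin_M A k $$ (i, j) = (LINT x|unif01. basis_fun A k x * (basis_fun A i x * basis_fun A j x))"
      using ij by (simp add: galerkin_M_def inner_P_def)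
    also have "\<dots> = (LINT x|unif01. (\<lambda>l. A $$ (k, l) * (A $$ (i, l) * A $$ (j, l))) (cell n x))"
      by (intro integral_cong_AE) (use AE_basis_fun in \<open>auto elim: eventually_mono\<close>)
    also have "\<dots> = (\<Sum>l<n. A $$ (k, l) * (A $$ (i, l) * A $$ (j, l))) / real n"
      by (rule integral_cell[OF pos])
    finally show ?thesis .
  qed
  have "galerkin_P A u $$ (i, j) = (\<Sum>k<n. \<Sum>l<n. u $ k * (A $$ (k, l) * (A $$ (i, l) * A $$ (j, l)))) / real n"
    using ij by (simp add: galerkin_P_def M sum_distrib_left sum_divide_distrib)
  also have "\<dots> = (\<Sum>l<n. cell_val A u l * (A $$ (i, l) * A $$ (j, l))) / real n"
    by (subst sum.swap) (simp add: cell_val_def sum_distrib_right mult.assoc)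
  finally show "galerkin_P A u $$ (i, j) = conj_diag (cell_val A u) $$ (i, j)"
    using ij by (simp add: conj_diag_index algebra_simps)
qed (simp_all add: galerkin_P_def)

lemma haar_D_eq: "haar_D A u = mat_diag n (cell_val A u)"
  unfolding haar_D_def galerkin_P_eq by (rule haar_H_conj_diag)

lemma haar_D_index: "l < n \<Longrightarrow> haar_D A u $$ (l, l) = cell_val A u l"
  by (simp add: haar_D_eq mat_diag_def)

lemma diag_fun_haar_D: "diag_fun f (haar_D A u) = mat_diag n (\<lambda>l. f (cell_val A u l))"
  by (auto simp: diag_fun_def haar_D_eq mat_diag_def)

lemma conj_diag_fun:
  "haar_H A * diag_fun f (haar_D A u) * transpose_mat (haar_H A) = conj_diag (\<lambda>l. f (cell_val A u l))"
  by (simp add: diag_fun_haar_D conj_diag_def)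

lemma modes_pow_eq: "modes_pow A \<gamma> u = modes_of (\<lambda>l. rpow (cell_val A u l) \<gamma>)"
  by (simp add: modes_pow_def conj_diag_fun conj_diag_e1)

lemma modes_sign_eq: "modes_sign A u = modes_of (\<lambda>l. sgn (cell_val A u l))"
  by (simp add: modes_sign_def conj_diag_fun conj_diag_e1)

lemma galerkin_prod_eq:
  "v \<in> carrier_vec n \<Longrightarrow> galerkin_prod A u v = modes_of (\<lambda>l. cell_val A u l * cell_val A v l)"
  by (simp add: galerkin_prod_def galerkin_P_eq conj_diag_mult_vec)

lemma modes_abs_eq:
  "u \<in> carrier_vec n \<Longrightarrow> modes_abs A u = modes_of (\<lambda>l. \<bar>cell_val A u l\<bar>)"
  by (simp add: modes_abs_def galerkin_prod_eq modes_sign_eq cong: modes_of_cong)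
    (simp add: sgn_mult_self_eq abs_sgn mult.commute)

lemma modes_abs_pow_eq: "modes_abs_pow A p u = modes_of (\<lambda>l. rpow \<bar>cell_val A u l\<bar> p)"
  using conj_diag_fun[of "\<lambda>x. rpow \<bar>x\<bar> p"] by (simp add: modes_abs_pow_def conj_diag_e1)

lemma sum_modes_modes_of: "sum_modes A d (\<lambda>i. modes_of (f i)) = modes_of (\<lambda>l. \<Sum>i=1..d. f i l)"
proof (rule eq_vecI)
  fix k assume "k < dim_vec (modes_of (\<lambda>l. \<Sum>i=1..d. f i l))"
  then have k: "k < n" by (simp add: modes_of_def)
  have "(\<Sum>i=1..d. (\<Sum>l<n. A $$ (k, l) * f i l)) = (\<Sum>l<n. A $$ (k, l) * (\<Sum>i=1..d. f i l))"
    by (subst sum.swap) (simp add: sum_distrib_left)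
  then show "sum_modes A d (\<lambda>i. modes_of (f i)) $ k = modes_of (\<lambda>l. \<Sum>i=1..d. f i l) $ k"
    using k by (simp add: sum_modes_def modes_of_def sum_divide_distrib[symmetric])
qed (simp add: sum_modes_def modes_of_def)

lemma sum_modes_cong: "(\<And>i. i \<in> {1..d} \<Longrightarrow> f i = g i) \<Longrightarrow> sum_modes A d f = sum_modes A d g"
  by (auto simp: sum_modes_def intro!: eq_vecI sum.cong)

lemma modes_norm1_eq: "modes_norm1 A d us = modes_of (\<lambda>l. \<Sum>i=1..d. \<bar>cell_val A (us i) l\<bar>)"
  by (simp add: modes_norm1_def conj_diag_fun conj_diag_e1 sum_modes_modes_of)

lemma modes_c_eq: "modes_c A p d us = modes_of (\<lambda>l. \<Sum>i=1..d. rpow \<bar>cell_val A (us i) l\<bar> p)"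
  by (simp add: modes_c_def modes_abs_pow_eq sum_modes_modes_of)

lemma modes_norm_eq:
  assumes "1 \<le> p"
  shows "modes_norm A p d us = modes_of (\<lambda>l. pnorm p d (\<lambda>i. cell_val A (us i) l))"
proof -
  have "modes_norm A p d us = modes_of (\<lambda>l. rpow \<bar>cell_val A (modes_c A p d us) l\<bar> (1 / p))"
    using conj_diag_fun[of "\<lambda>x. rpow \<bar>x\<bar> (1 / p)"] by (simp add: modes_norm_def conj_diag_e1)
  also have "\<dots> = modes_of (\<lambda>l. pnorm p d (\<lambda>i. cell_val A (us i) l))"
    \<comment> \<open>The outer absolute value disappears because the cell values of
      \<open>modes_c\<close> are sums of nonnegative terms, and \<open>rpow\<close> agrees with
      \<open>powr\<close> because \<open>p\<close> and \<open>1 / p\<close> are nonzero.\<close>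
    using assms by (intro modes_of_cong) (simp add: modes_c_eq pnorm_def rpow_def sum_nonneg)
  finally show ?thesis .
qed

lemma galerkin_power_eq: "galerkin_power A m u = modes_of (\<lambda>l. cell_val A u l ^ m)"
proof -
  have c: "galerkin_P A u \<in> carrier_mat n n" by (simp add: galerkin_P_eq)
  have "(galerkin_P A u ^\<^sub>m m) *\<^sub>v v = modes_of (\<lambda>l. cell_val A u l ^ m * cell_val A v l)"
    if "v \<in> carrier_vec n" for v
    using that
  \<comment> \<open>The vector must be arbitrary: the recursion of the matrix power splits off the
    factor next to \<open>v\<close>, so the induction hypothesis is used at
    \<open>galerkin_P A u\<close> applied to \<open>v\<close>.\<close>
  proof (induction m arbitrary: v)
    case 0
    then show ?case using c by (simp add: modes_of_cell_val)
  next
    case (Suc m)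
    have "(galerkin_P A u ^\<^sub>m Suc m) *\<^sub>v v = galerkin_P A u ^\<^sub>m m *\<^sub>v (galerkin_P A u *\<^sub>v v)"
      using c Suc.prems by (simp add: assoc_mult_mat_vec[of _ n n _ n] pow_carrier_mat)
    also have "galerkin_P A u *\<^sub>v v = modes_of (\<lambda>l. cell_val A u l * cell_val A v l)"
      using Suc.prems by (simp add: galerkin_P_eq conj_diag_mult_vec)
    finally show ?case
      by (simp add: Suc.IH ac_simps cong: modes_of_cong)
  qed
  from this[OF e1_carrier] show ?thesis
    by (simp add: galerkin_power_def cong: modes_of_cong)
qed

text \<open>The quadratic form of \<open>conj_diag f\<close> at \<open>x\<close> is the average over
  the cells of \<open>f\<close> times the squared cell values of \<open>x\<close>. Testing it on the
  modes of the indicator of a single cell isolates one value of \<open>f\<close>.\<close>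

lemma psd_modes_iff: "u \<in> psd_modes A \<longleftrightarrow> u \<in> carrier_vec n \<and> (\<forall>l<n. 0 \<le> cell_val A u l)"
proof -
  have quad: "scalar_prod x (conj_diag f *\<^sub>v x) = (\<Sum>l<n. f l * (cell_val A x l)\<^sup>2) / real n"
    if "x \<in> carrier_vec n" for x f
  proof -
    have "scalar_prod x (conj_diag f *\<^sub>v x)
        = (\<Sum>k<n. \<Sum>l<n. x $ k * (A $$ (k, l) * (f l * cell_val A x l))) / real n"
      using that by (simp add: conj_diag_mult_vec modes_of_def scalar_prod_def
          lessThan_atLeast0[symmetric] sum_distrib_left sum_divide_distrib)
    also have "\<dots> = (\<Sum>l<n. f l * cell_val A x l * cell_val A x l) / real n"
      by (subst sum.swap) (simp add: cell_val_def[of A x] sum_distrib_left ac_simps)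
    finally show ?thesis by (simp add: power2_eq_square mult.assoc)
  qed
  have sym: "transpose_mat (conj_diag f) = conj_diag f" for f
    by (intro eq_matI) (auto simp: conj_diag_index ac_simps)
  have "(\<forall>x\<in>carrier_vec n. 0 \<le> scalar_prod x (conj_diag f *\<^sub>v x)) \<longleftrightarrow> (\<forall>l<n. 0 \<le> f l)" for f
  proof safe
    fix j assume *: "\<forall>x\<in>carrier_vec n. 0 \<le> scalar_prod x (conj_diag f *\<^sub>v x)" and j: "j < n"
    have "0 \<le> (\<Sum>l<n. f l * (cell_val A (modes_of (\<lambda>l. if l = j then 1 else 0)) l)\<^sup>2) / real n"
      using bspec[OF * modes_of_carrier] by (simp only: quad[OF modes_of_carrier])
    also have "\<dots> = (\<Sum>l<n. if l = j then f l else 0) / real n"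
      by (intro arg_cong2[where f="(/)"] sum.cong) auto
    finally show "0 \<le> f j" using j pos by (simp add: field_simps)
  next
    fix x :: "real vec" assume "\<forall>l<n. 0 \<le> f l" "x \<in> carrier_vec n"
    then show "0 \<le> scalar_prod x (conj_diag f *\<^sub>v x)"
      by (auto simp: quad intro!: divide_nonneg_nonneg sum_nonneg)
  qed
  then show ?thesis
    by (auto simp: psd_modes_def pos_semidef_def galerkin_P_eq sym)
qed

text \<open>The root is defined as an inverse function, so it is identified by exhibiting a preimage
  in \<open>psd_modes A\<close> together with injectivity there. The latter is uniqueness of
  nonnegative \<open>m\<close>-th roots in each cell.\<close>

lemma galerkin_root_eqI:
  assumes "0 < m" and r: "\<And>l. l < n \<Longrightarrow> 0 \<le> r l \<and> r l ^ m = cell_val A u l" and "u \<in> carrier_vec n"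
  shows "galerkin_root A m u = modes_of r"
  unfolding galerkin_root_def
proof (rule the_inv_into_f_eq)
  show "inj_on (galerkin_power A m) (psd_modes A)"
  proof (rule inj_onI)
    fix v w assume *: "v \<in> psd_modes A" "w \<in> psd_modes A" "galerkin_power A m v = galerkin_power A m w"
    show "v = w"
    proof (rule modes_eqI)
      fix l assume l: "l < n"
      have "cell_val A v l ^ m = cell_val A w l ^ m"
        using arg_cong[OF *(3), of "\<lambda>u. cell_val A u l"] l by (simp add: galerkin_power_eq)
      then show "cell_val A v l = cell_val A w l"
        using *(1,2) l assms(1) by (auto intro: power_eq_imp_eq_base simp: psd_modes_iff)
    qed (use *(1,2) in \<open>simp_all add: psd_modes_iff\<close>)
  qed
  show "galerkin_power A m (modes_of r) = u"
    by (rule modes_eqI) (use r assms(3) in \<open>simp_all add: galerkin_power_eq\<close>)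
  show "modes_of r \<in> psd_modes A"
    using r by (auto simp: psd_modes_iff)
qed

text \<open>In the coordinates given by the cell values every mode map acts separately on each
  coordinate, so its Jacobian is diagonal there; \<open>cell_val_vnorm\<close> transfers the error bound.\<close>

lemma has_jacobian_conj_diag:
  assumes S: "S \<subseteq> carrier_vec n" and u: "u \<in> S"
    and F: "\<And>v. v \<in> S \<Longrightarrow> F v \<in> carrier_vec n"
    and val: "\<And>v l. v \<in> S \<Longrightarrow> l < n \<Longrightarrow> cell_val A v l \<in> T l \<and> cell_val A (F v) l = \<phi> l (cell_val A v l)"
    and der: "\<And>l. l < n \<Longrightarrow> (\<phi> l has_real_derivative f' l) (at (cell_val A u l) within T l)"
  shows "has_jacobian F (conj_diag f') S u"
  unfolding has_jacobian_def
proof (intro allI impI)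
  fix \<epsilon> :: real assume \<epsilon>: "\<epsilon> > 0"
  let ?x = "cell_val A u"
  have "\<exists>\<delta>>0. \<forall>y\<in>T l. \<bar>y - ?x l\<bar> < \<delta> \<longrightarrow> \<bar>\<phi> l y - \<phi> l (?x l) - f' l * (y - ?x l)\<bar> \<le> \<epsilon> * \<bar>y - ?x l\<bar>"
    if "l < n" for l
    using der[OF that] \<epsilon> unfolding has_field_derivative_def has_derivative_within_alt by simp
  then obtain \<delta> where \<delta>: "\<And>l. l < n \<Longrightarrow> 0 < \<delta> l" "\<And>l y. l < n \<Longrightarrow> y \<in> T l \<Longrightarrow> \<bar>y - ?x l\<bar> < \<delta> l \<Longrightarrow>
      \<bar>\<phi> l y - \<phi> l (?x l) - f' l * (y - ?x l)\<bar> \<le> \<epsilon> * \<bar>y - ?x l\<bar>"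
    by metis
  \<comment> \<open>A single cell value is at most \<open>sqrt n\<close> times \<open>vnorm\<close>,
    so this radius keeps every cell value within its own tolerance
    \<open>\<delta> l\<close>.\<close>
  define D where "D = Min (\<delta> ` {..<n}) / sqrt (real n)"
  have fin: "finite (\<delta> ` {..<n})" "\<delta> ` {..<n} \<noteq> {}" using pos by auto
  have D: "0 < D" using \<delta>(1) fin pos by (auto simp: D_def)
  have small: "\<bar>cell_val A w l\<bar> < \<delta> l" if "w \<in> carrier_vec n" "vnorm w < D" "l < n" for w l
  proof -
    have "(cell_val A w l)\<^sup>2 \<le> (\<Sum>l<n. (cell_val A w l)\<^sup>2)"
      using that by (intro member_le_sum) auto
    also have "\<dots> = (sqrt (real n) * vnorm w)\<^sup>2"
      using that by (simp add: cell_val_vnorm power_mult_distrib)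
    finally have "\<bar>cell_val A w l\<bar> \<le> sqrt (real n) * vnorm w"
      using that by (subst (asm) abs_le_square_iff[symmetric])
        (simp add: vnorm_def scalar_prod_def sum_nonneg abs_mult)
    also have "\<dots> < sqrt (real n) * D" using that pos by simp
    also have "\<dots> \<le> \<delta> l" using fin that pos by (auto simp: D_def)
    finally show ?thesis .
  qed
  show "\<exists>\<delta>>0. \<forall>v\<in>S. vnorm (v - u) < \<delta> \<longrightarrow>
      vnorm (F v - F u - conj_diag f' *\<^sub>v (v - u)) \<le> \<epsilon> * vnorm (v - u)"
  proof (intro exI[of _ D] conjI ballI impI D)
    fix v assume v: "v \<in> S" "vnorm (v - u) < D"
    let ?w = "v - u" and ?r = "F v - F u - conj_diag f' *\<^sub>v (v - u)"
    have "u \<in> carrier_vec n" "v \<in> carrier_vec n" using S u v by auto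
    then have cu: "u \<in> carrier_vec n" "v \<in> carrier_vec n" "?w \<in> carrier_vec n"
      "F v \<in> carrier_vec n" "F u \<in> carrier_vec n"
      using F[OF u] F[OF v(1)] by (auto simp del: carrier_vecD)
    have cr: "?r \<in> carrier_vec n" using cu by (simp add: conj_diag_mult_vec)
    have "\<bar>cell_val A ?r l\<bar> \<le> \<bar>\<epsilon> * cell_val A ?w l\<bar>" if l: "l < n" for l
    proof -
      have "\<bar>cell_val A v l - ?x l\<bar> < \<delta> l"
        using small[OF cu(3) v(2) l] cu by (simp add: cell_val_minus)
      moreover have "cell_val A ?r l = \<phi> l (cell_val A v l) - \<phi> l (?x l) - f' l * (cell_val A v l - ?x l)"
        using cu l val[OF v(1) l] val[OF u l] by (simp add: cell_val_minus conj_diag_mult_vec)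
      ultimately show ?thesis
        using \<delta>(2)[OF l, of "cell_val A v l"] val[OF v(1) l] cu \<epsilon>
        by (simp add: cell_val_minus abs_mult)
    qed
    then have "(\<Sum>l<n. (cell_val A ?r l)\<^sup>2) \<le> (\<Sum>l<n. (\<epsilon> * cell_val A ?w l)\<^sup>2)"
      by (intro sum_mono) (auto simp: abs_le_square_iff)
    also have "\<dots> = \<epsilon>\<^sup>2 * (\<Sum>l<n. (cell_val A ?w l)\<^sup>2)"
      by (simp add: power_mult_distrib sum_distrib_left)
    finally have "(vnorm ?r)\<^sup>2 \<le> (\<epsilon> * vnorm ?w)\<^sup>2"
      using pos by (simp add: cell_val_vnorm[OF cr] cell_val_vnorm[OF cu(3)] power_mult_distrib)
    then show "vnorm ?r \<le> \<epsilon> * vnorm ?w"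
      by (rule power2_le_imp_le) (use \<epsilon> in \<open>auto simp: vnorm_def scalar_prod_def sum_nonneg\<close>)
  qed
qed

end

section \<open>Haar-type matrices\<close>

text \<open>The factor \<open>haar_s K j\<close> is minus the number of columns from
  \<open>j\<close> on. Hence the pairing of row \<open>j\<close> with \<open>g\<close> compares the
  sum of \<open>g\<close> over these columns with that many copies of \<open>g (j - 1)\<close>, and
  it vanishes whenever \<open>g\<close> is constant from column \<open>j - 1\<close> on.\<close>

lemma haar_canonical_sum:
  assumes "0 < j" "j \<le> K"
  shows "(\<Sum>l<K + 1. g l * haar_canonical K $$ (j, l))
     = haar_r K j * ((\<Sum>l=j..<K + 1. g l) - real (K + 1 - j) * g (j - 1))"
proof -
  obtain m where m: "j = Suc m" using assms by (cases j) auto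
  let ?f = "\<lambda>l. g l * haar_canonical K $$ (j, l)"
  have "(\<Sum>l<K + 1. ?f l) = (\<Sum>l=0..<m. ?f l) + (\<Sum>l=m..<K + 1. ?f l)"
    using assms m by (simp add: lessThan_atLeast0 sum.atLeastLessThan_concat)
  also have "(\<Sum>l=m..<K + 1. ?f l) = ?f m + (\<Sum>l=Suc m..<K + 1. ?f l)"
    using assms m by (intro sum.atLeast_Suc_lessThan) auto
  also have "(\<Sum>l=0..<m. ?f l) = 0"
    using assms m by (intro sum.neutral) (auto simp: haar_canonical_def)
  also have "(\<Sum>l=Suc m..<K + 1. ?f l) = (\<Sum>l=Suc m..<K + 1. g l * haar_r K j)"
    using assms m by (intro sum.cong) (auto simp: haar_canonical_def)
  also have "\<dots> = (\<Sum>l=j..<K + 1. g l) * haar_r K j"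
    by (simp only: sum_distrib_right m)
  also have "?f m = g m * haar_d K j"
    using assms m by (auto simp: haar_canonical_def)
  finally show ?thesis
    using assms m by (simp add: haar_d_def haar_s_def of_nat_diff algebra_simps)
qed

text \<open>For \<open>i < j\<close>, row \<open>i\<close> is constant from column
  \<open>j - 1\<close> on, which gives orthogonality by \<open>haar_canonical_sum\<close>. With
  \<open>t = - haar_s K j\<close>, row \<open>j\<close> has squared length \<open>t^2 + t\<close>
  times the square of \<open>haar_r K j\<close>, and \<open>haar_r\<close> is the normalisation that
  turns this into \<open>K + 1\<close>.\<close>

lemma haar_canonical_orth:
  "haar_canonical K * transpose_mat (haar_canonical K) = real (K + 1) \<cdot>\<^sub>m 1\<^sub>m (K + 1)"
proof -
  let ?A = "haar_canonical K"
  have d: "dim_row ?A = K + 1" "dim_col ?A = K + 1" by (simp_all add: haar_canonical_def)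
  have lt: "(\<Sum>l<K + 1. ?A $$ (i, l) * ?A $$ (j, l)) = 0" if "i < j" "j \<le> K" for i j
  proof -
    define c where "c = (if i = 0 then 1 else haar_r K i)"
    have c: "?A $$ (i, l) = c" if "j - 1 \<le> l" "l \<le> K" for l
      using that \<open>i < j\<close> \<open>j \<le> K\<close> by (auto simp: haar_canonical_def c_def)
    have "(\<Sum>l=j..<K + 1. ?A $$ (i, l)) = (\<Sum>l=j..<K + 1. c)"
      using that by (intro sum.cong) (auto simp: c)
    also have "\<dots> = real (K + 1 - j) * c" by simp
    finally show ?thesis
      using that by (subst haar_canonical_sum) (auto simp: c)
  qed
  have eq: "(\<Sum>l<K + 1. ?A $$ (j, l) * ?A $$ (j, l)) = real (K + 1)" if "j \<le> K" for j
  proof (cases "j = 0")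
    case True then show ?thesis by (simp add: haar_canonical_def)
  next
    case False
    define t where "t = real (K + 1 - j)"
    have t: "0 < t" and s: "haar_s K j = - t" using that by (auto simp: t_def haar_s_def of_nat_diff)
    have r: "(haar_r K j)\<^sup>2 * (t\<^sup>2 + t) = real K + 1"
    proof -
      have "0 < t\<^sup>2 + t" using t by (simp add: add_pos_pos)
      then show ?thesis by (simp add: haar_r_def s)
    qed
    have "(\<Sum>l=j..<K + 1. ?A $$ (j, l)) = (\<Sum>l=j..<K + 1. haar_r K j)"
      using that False by (intro sum.cong) (auto simp: haar_canonical_def)
    also have "\<dots> = t * haar_r K j" by (simp add: t_def)
    moreover have "?A $$ (j, j - 1) = - t * haar_r K j"
      using that False by (auto simp: haar_canonical_def haar_d_def s)
    ultimately have "(\<Sum>l<K + 1. ?A $$ (j, l) * ?A $$ (j, l)) = (haar_r K j)\<^sup>2 * (t\<^sup>2 + t)"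
      using that False by (subst haar_canonical_sum) (auto simp: t_def[symmetric] power2_eq_square algebra_simps)
    then show ?thesis by (simp add: r)
  qed
  show ?thesis
  proof (rule eq_matI)
    fix i j assume "i < dim_row (real (K + 1) \<cdot>\<^sub>m 1\<^sub>m (K + 1))" "j < dim_col (real (K + 1) \<cdot>\<^sub>m 1\<^sub>m (K + 1))"
    then have ij: "i \<le> K" "j \<le> K" by auto
    have "(?A * transpose_mat ?A) $$ (i, j) = (\<Sum>l<K + 1. ?A $$ (i, l) * ?A $$ (j, l))"
      using ij d by (simp add: scalar_prod_def lessThan_atLeast0)
    also have "\<dots> = (if i = j then real (K + 1) else 0)"
      using lt[of i j] lt[of j i] eq[of i] ij
      by (cases i j rule: linorder_cases) (simp_all add: mult.commute)
    finally show "(?A * transpose_mat ?A) $$ (i, j) = (real (K + 1) \<cdot>\<^sub>m 1\<^sub>m (K + 1)) $$ (i, j)"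
      using ij by simp
  qed (simp_all add: d)
qed

text \<open>Multiplication from the left by the orthogonal block matrix \<open>B\<close> preserves
  the row relations of the canonical matrix. It also preserves row 0, since row 0 of
  \<open>B\<close> is the first unit vector.\<close>

lemma haar_matrix_haar_type:
  assumes "orthonormal_mat K Q"
  shows "haar_matrix (haar_type K Q) (K + 1)"
proof -
  let ?C = "haar_canonical K" and ?n = "K + 1"
  let ?A = "haar_type K Q"
  define B where "B = four_block_mat (1\<^sub>m 1) (0\<^sub>m 1 K) (0\<^sub>m K 1) Q"
  have Q: "Q \<in> carrier_mat K K" "Q * transpose_mat Q = 1\<^sub>m K"
    using assms by (auto simp: orthonormal_mat_def)
  have C: "?C \<in> carrier_mat ?n ?n" by (simp add: haar_canonical_def)
  have B: "B \<in> carrier_mat ?n ?n" unfolding B_def using four_block_carrier_mat[of "1\<^sub>m 1" 1 1 Q K K "0\<^sub>m 1 K"] Q by simp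
  have A: "?A = B * ?C" by (simp add: haar_type_def B_def)
  have Ac: "?A \<in> carrier_mat ?n ?n" unfolding A using B C by (rule mult_carrier_mat)
  have tB: "transpose_mat B = four_block_mat (1\<^sub>m 1) (0\<^sub>m 1 K) (0\<^sub>m K 1) (transpose_mat Q)"
    unfolding B_def using Q by (subst transpose_four_block_mat[of _ 1 1 _ K _ K]) auto
  have BB: "B * transpose_mat B = 1\<^sub>m ?n"
    unfolding tB unfolding B_def using Q
    by (subst mult_four_block_mat[of _ 1 1 _ K _ K _ _ 1 _ K]) (auto intro!: eq_matI)
  have "?A * transpose_mat ?A = B * ?C * (transpose_mat ?C * transpose_mat B)"
    unfolding A using B C by (simp add: transpose_mult[of _ ?n ?n])
  also have "\<dots> = B * (?C * transpose_mat ?C) * transpose_mat B"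
    using B C by (smt (verit) assoc_mult_mat mult_carrier_mat transpose_carrier_mat)
  also have "\<dots> = real ?n \<cdot>\<^sub>m (B * transpose_mat B)"
  proof -
    have "B * (real ?n \<cdot>\<^sub>m 1\<^sub>m ?n) = real ?n \<cdot>\<^sub>m B"
      using B by (metis mult_smult_distrib one_carrier_mat right_mult_one_mat)
    then show ?thesis
      unfolding haar_canonical_orth using B by (metis mult_smult_assoc_mat transpose_carrier_mat)
  qed
  finally have AA: "?A * transpose_mat ?A = real ?n \<cdot>\<^sub>m 1\<^sub>m ?n" by (simp add: BB)
  \<comment> \<open>Column orthogonality comes from row orthogonality: the right inverse
    \<open>?T\<close> of the square matrix is also its left inverse.\<close>
  let ?T = "(1 / real ?n) \<cdot>\<^sub>m transpose_mat ?A"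
  have T: "?T \<in> carrier_mat ?n ?n" using Ac by simp
  have "?A * ?T = (1 / real ?n) \<cdot>\<^sub>m (?A * transpose_mat ?A)"
    using Ac by (intro mult_smult_distrib) auto
  also have "\<dots> = 1\<^sub>m ?n" unfolding AA by (intro eq_matI) auto
  finally have "?T * ?A = 1\<^sub>m ?n"
    using mat_mult_left_right_inverse Ac T by blast
  then have "(1 / real ?n) \<cdot>\<^sub>m (transpose_mat ?A * ?A) = 1\<^sub>m ?n"
    using Ac by (metis mult_smult_assoc_mat transpose_carrier_mat)
  then have "real ?n \<cdot>\<^sub>m ((1 / real ?n) \<cdot>\<^sub>m (transpose_mat ?A * ?A)) = real ?n \<cdot>\<^sub>m 1\<^sub>m ?n"
    by (rule arg_cong)
  moreover have "real ?n \<cdot>\<^sub>m ((1 / real ?n) \<cdot>\<^sub>m X) = X" for X :: "real mat"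
    by (intro eq_matI) auto
  ultimately have TA: "transpose_mat ?A * ?A = real ?n \<cdot>\<^sub>m 1\<^sub>m ?n" by (simp only:)
  have row0: "?A $$ (0, l) = 1" if "l < ?n" for l
  proof -
    have "?A $$ (0, l) = (\<Sum>k<?n. B $$ (0, k) * ?C $$ (k, l))"
      unfolding A using B C that by (simp add: scalar_prod_def lessThan_atLeast0)
    also have "\<dots> = (\<Sum>k<?n. if k = 0 then ?C $$ (0, l) else 0)"
      using Q by (intro sum.cong) (auto simp: B_def)
    also have "\<dots> = 1" using that by (simp add: haar_canonical_def)
    finally show ?thesis .
  qed
  show ?thesis by unfold_locales (use Ac AA TA row0 in auto)
qed

section \<open>The \<open>p\<close>-norm\<close>

text \<open>For positive arguments this is convexity of the power function. If one argument is 0 it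
  reduces to \<open>(r * c) powr p \<le> r * c powr p\<close> for \<open>0 \<le> r \<le> 1\<close>,
  which holds because \<open>r powr p \<le> r\<close>.\<close>

lemma powr_convex_combination:
  fixes a b t :: real
  assumes "1 \<le> p" "0 \<le> a" "0 \<le> b" "0 \<le> s" "0 \<le> t" "s + t = 1"
  shows "(s * a + t * b) powr p \<le> s * a powr p + t * b powr p"
proof -
  have one: "(r * c) powr p \<le> r * c powr p" if "0 \<le> r" "r \<le> 1" "0 \<le> c" for r c :: real
  proof -
    have "r powr p \<le> r powr 1" if "0 < r" using that \<open>r \<le> 1\<close> assms(1) by (intro powr_mono') auto
    then have "r powr p \<le> r" using \<open>0 \<le> r\<close> by (cases "r = 0") auto
    then show ?thesis using that by (simp add: powr_mult mult_right_mono)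
  qed
  consider "a = 0" | "b = 0" | "0 < a" "0 < b" using assms by fastforce
  then show ?thesis
  proof cases
    case 3
    have s: "s = 1 - t" using assms by simp
    show ?thesis
      unfolding s using convex_onD[OF powr_convex[OF assms(1)], of t a b] assms 3 by simp
  qed (use one[of t b] one[of s a] assms in auto)
qed

lemma pnorm_nonneg [simp]: "0 \<le> pnorm p d a"
  by (simp add: pnorm_def)

lemma pnorm_powr: "1 \<le> p \<Longrightarrow> pnorm p d a powr p = (\<Sum>i=1..d. \<bar>a i\<bar> powr p)"
  by (simp add: pnorm_def powr_powr sum_nonneg)

lemma pnorm_eq_0:
  assumes "1 \<le> p" "pnorm p d a = 0" "i \<in> {1..d}" shows "a i = 0"
proof -
  have "(\<Sum>i=1..d. \<bar>a i\<bar> powr p) = 0" using pnorm_powr[OF assms(1), of d a] assms by simp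
  then show ?thesis using assms(3) by (subst (asm) sum_nonneg_eq_0_iff) auto
qed

lemma pnorm_leI:
  assumes "1 \<le> p" "0 \<le> c" "(\<Sum>i=1..d. \<bar>a i\<bar> powr p) \<le> c powr p" shows "pnorm p d a \<le> c"
proof -
  have "pnorm p d a \<le> (c powr p) powr (1 / p)"
    unfolding pnorm_def using assms by (intro powr_mono2) (auto intro: sum_nonneg)
  then show ?thesis using assms by (simp add: powr_powr)
qed

lemma pnorm_cong: "(\<And>i. i \<in> {1..d} \<Longrightarrow> a i = b i) \<Longrightarrow> pnorm p d a = pnorm p d b"
  by (simp add: pnorm_def)

text \<open>Minkowski's inequality by normalisation: \<open>a\<close> and \<open>b\<close> are
  scaled to norm 1, convexity is applied with weights proportional to the two norms, and the
  weighted sums then add up to 1. Zero norms are treated separately, as they cannot be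
  scaled.\<close>

lemma pnorm_triangle:
  assumes p: "1 \<le> p"
  shows "pnorm p d (\<lambda>i. a i + b i) \<le> pnorm p d a + pnorm p d b"
proof -
  let ?N = "pnorm p d a" and ?M = "pnorm p d b"
  consider "?N = 0" | "?M = 0" | "0 < ?N" "0 < ?M"
    using pnorm_nonneg[of p d a] pnorm_nonneg[of p d b] by linarith
  then show ?thesis
  proof cases
    case 1
    then have "pnorm p d (\<lambda>i. a i + b i) = ?M" using pnorm_eq_0[OF p] by (intro pnorm_cong) auto
    then show ?thesis by simp
  next
    case 2
    then have "pnorm p d (\<lambda>i. a i + b i) = ?N" using pnorm_eq_0[OF p] by (intro pnorm_cong) auto
    then show ?thesis by simp
  next
    case 3
    let ?s = "?N / (?N + ?M)" and ?t = "?M / (?N + ?M)"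
    have st: "0 \<le> ?s" "0 \<le> ?t" "?s + ?t = 1" using 3 by (auto simp: add_divide_distrib[symmetric])
    have "\<bar>a i + b i\<bar> powr p \<le> (?N + ?M) powr p * (?s * (\<bar>a i\<bar> powr p / ?N powr p) + ?t * (\<bar>b i\<bar> powr p / ?M powr p))" for i
    proof -
      have "(?N + ?M) * (?s * (\<bar>a i\<bar> / ?N) + ?t * (\<bar>b i\<bar> / ?M)) = \<bar>a i\<bar> + \<bar>b i\<bar>"
        using 3 by (simp add: distrib_left)
      then have "\<bar>a i + b i\<bar> powr p \<le> ((?N + ?M) * (?s * (\<bar>a i\<bar> / ?N) + ?t * (\<bar>b i\<bar> / ?M))) powr p"
        using p by (intro powr_mono2) auto
      also have "\<dots> = (?N + ?M) powr p * (?s * (\<bar>a i\<bar> / ?N) + ?t * (\<bar>b i\<bar> / ?M)) powr p"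
        using 3 by (intro powr_mult)
      also have "\<dots> \<le> (?N + ?M) powr p * (?s * (\<bar>a i\<bar> / ?N) powr p + ?t * (\<bar>b i\<bar> / ?M) powr p)"
        using 3 p st by (intro mult_left_mono powr_convex_combination) auto
      finally show ?thesis using 3 by (simp add: powr_divide)
    qed
    then have "(\<Sum>i=1..d. \<bar>a i + b i\<bar> powr p) \<le> (\<Sum>i=1..d. (?N + ?M) powr p * (?s * (\<bar>a i\<bar> powr p / ?N powr p) + ?t * (\<bar>b i\<bar> powr p / ?M powr p)))"
      by (intro sum_mono)
    also have "\<dots> = (?N + ?M) powr p * (?s * ((\<Sum>i=1..d. \<bar>a i\<bar> powr p) / ?N powr p) + ?t * ((\<Sum>i=1..d. \<bar>b i\<bar> powr p) / ?M powr p))"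
      by (simp only: sum_distrib_left[symmetric] sum.distrib sum_divide_distrib[symmetric])
    also have "\<dots> = (?N + ?M) powr p"
      unfolding pnorm_powr[OF p, symmetric] using 3 st by simp
    finally show ?thesis using p by (intro pnorm_leI) auto
  qed
qed

text \<open>One factor of \<open>x powr p = x * x powr (p - 1)\<close> is kept and the other is
  bounded using that each entry is at most the whole sum.\<close>

lemma pnorm_le_sum:
  assumes p: "1 \<le> p" shows "pnorm p d a \<le> (\<Sum>i=1..d. \<bar>a i\<bar>)"
proof (rule pnorm_leI[OF p])
  let ?S = "\<Sum>i=1..d. \<bar>a i\<bar>"
  have split: "x powr p = x * x powr (p - 1)" if "0 \<le> x" for x :: real
    using that by (cases "x = 0") (auto simp: powr_mult_base)
  show "0 \<le> ?S" by (simp add: sum_nonneg)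
  have "(\<Sum>i=1..d. \<bar>a i\<bar> powr p) \<le> (\<Sum>i=1..d. \<bar>a i\<bar> * ?S powr (p - 1))"
  proof (rule sum_mono)
    fix i assume "i \<in> {1..d}"
    then have "\<bar>a i\<bar> \<le> ?S" by (intro member_le_sum) auto
    then show "\<bar>a i\<bar> powr p \<le> \<bar>a i\<bar> * ?S powr (p - 1)"
      using p by (subst split) (auto intro!: mult_left_mono powr_mono2)
  qed
  also have "\<dots> = ?S powr p" using \<open>0 \<le> ?S\<close> by (simp add: split sum_distrib_right)
  finally show "(\<Sum>i=1..d. \<bar>a i\<bar> powr p) \<le> ?S powr p" .
qed

lemma pnorm_lipschitz:
  assumes p: "1 \<le> p" shows "\<bar>pnorm p d a - pnorm p d b\<bar> \<le> (\<Sum>i=1..d. \<bar>a i - b i\<bar>)"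
proof -
  have "pnorm p d a \<le> pnorm p d b + (\<Sum>i=1..d. \<bar>a i - b i\<bar>)" for a b
    using pnorm_triangle[OF p, of d b "\<lambda>i. a i - b i"] pnorm_le_sum[OF p, of d "\<lambda>i. a i - b i"] by simp
  from this[of a b] this[of b a] show ?thesis by (simp add: abs_minus_commute)
qed

text \<open>Isolates the coordinate that varies in a partial Jacobian, so that the norm becomes a
  function of one real variable.\<close>

lemma pnorm_coordinate:
  assumes "1 \<le> p" "i \<in> {1..d}"
  shows "pnorm p d a = ((\<Sum>j\<in>{1..d} - {i}. \<bar>a j\<bar> powr p) + rpow \<bar>a i\<bar> p) powr (1 / p)"
proof -
  have "(\<Sum>j=1..d. \<bar>a j\<bar> powr p) = \<bar>a i\<bar> powr p + (\<Sum>j\<in>{1..d} - {i}. \<bar>a j\<bar> powr p)"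
    by (rule sum.remove) (use assms in auto)
  then show ?thesis using assms by (simp add: pnorm_def rpow_def add.commute)
qed

section \<open>Jacobians\<close>

text \<open>At 0 the derivative is one-sided. For exponent 1 it is 1 by the convention
  \<open>rpow 0 0 = 1\<close>; for larger exponents the difference quotient
  \<open>y powr (\<gamma> - 1)\<close> tends to 0; exponents strictly between 0 and 1 have infinite
  slope there and are excluded.\<close>

lemma has_real_derivative_rpow:
  assumes "0 \<le> \<gamma>" "0 \<le> x" "0 < \<gamma> \<and> \<gamma> < 1 \<longrightarrow> x \<noteq> 0"
  shows "((\<lambda>y. rpow y \<gamma>) has_real_derivative \<gamma> * rpow x (\<gamma> - 1)) (at x within {0..})"
proof -
  consider "\<gamma> = 0" | "\<gamma> = 1" | "0 < \<gamma>" "\<gamma> \<noteq> 1" "0 < x" | "1 < \<gamma>" "x = 0" using assms by fastforce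
  then show ?thesis
  proof cases
    case 1
    then show ?thesis by (simp add: rpow_def)
  next
    case 2
    have "((\<lambda>y. rpow y \<gamma>) has_real_derivative 1) (at x within {0..})"
      by (rule has_field_derivative_transform_within[where f = "\<lambda>y. y" and d = 1])
        (use assms 2 in \<open>auto simp: rpow_def\<close>)
    then show ?thesis using 2 by (simp add: rpow_def)
  next
    case 3
    from 3(3) have "((\<lambda>y. y powr \<gamma>) has_real_derivative \<gamma> * x powr (\<gamma> - 1)) (at x within {0..})"
      by (rule has_field_derivative_at_within[OF has_real_derivative_powr])
    then show ?thesis using 3 by (simp add: rpow_def)
  next
    case 4
    have "((\<lambda>y. y powr (\<gamma> - 1)) \<longlongrightarrow> 0) (at 0 within {0..})"
      using 4 by (intro tendsto_zero_powrI[where b = "\<gamma> - 1"]) (auto simp: eventually_at_filter)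
    moreover have "\<forall>\<^sub>F y in at 0 within {0..}. y powr (\<gamma> - 1) = (rpow y \<gamma> - rpow 0 \<gamma>) / (y - 0)"
      using 4 by (auto simp: eventually_at_filter rpow_def powr_diff)
    ultimately have "((\<lambda>y. (rpow y \<gamma> - rpow 0 \<gamma>) / (y - 0)) \<longlongrightarrow> 0) (at 0 within {0..})"
      by (rule Lim_transform_eventually)
    then show ?thesis using 4 by (simp add: has_field_derivative_iff rpow_def)
  qed
qed

lemma has_real_derivative_abs:
  "x \<noteq> 0 \<Longrightarrow> (abs has_real_derivative sgn x) (at (x::real) within T)"
  by (rule has_field_derivative_at_within,
      rule has_field_derivative_transform_within[OF DERIV_cmult_Id[of "sgn x"], of "\<bar>x\<bar>"])
    (auto simp: sgn_if dist_real_def abs_if split: if_splits)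

text \<open>At \<open>x = 0\<close> the formula gives 0 because \<open>sgn 0 = 0\<close>; this is
  correct for \<open>p > 1\<close>, as the difference quotient is bounded in absolute value by
  \<open>\<bar>y\<bar> powr (p - 1)\<close>.\<close>

lemma has_real_derivative_rpow_abs:
  assumes p: "1 \<le> p" "p = 1 \<longrightarrow> x \<noteq> 0"
  shows "((\<lambda>y. rpow \<bar>y\<bar> p) has_real_derivative p * rpow \<bar>x\<bar> (p - 1) * sgn x) (at x)"
proof (cases "x = 0")
  case False
  \<comment> \<open>The outer derivative is available only within the nonnegative reals, which
    suffices as these contain the range of \<open>abs\<close>.\<close>
  have "((\<lambda>y. rpow y p) has_real_derivative p * rpow \<bar>x\<bar> (p - 1)) (at \<bar>x\<bar> within abs ` UNIV)"
    by (rule DERIV_subset[OF has_real_derivative_rpow]) (use p in auto)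
  from DERIV_image_chain[OF this has_real_derivative_abs[OF False]] show ?thesis
    by (simp add: o_def)
next
  case True
  then have p1: "1 < p" using p by auto
  have "((\<lambda>y. \<bar>y\<bar> powr (p - 1)) \<longlongrightarrow> 0) (at 0)"
    using p1 by (intro tendsto_zero_powrI[where b = "p - 1"] tendsto_rabs_zero) auto
  then have "((\<lambda>y. (rpow \<bar>y\<bar> p - rpow \<bar>0\<bar> p) / (y - 0)) \<longlongrightarrow> 0) (at 0)"
    by (rule Lim_null_comparison[rotated])
      (use p1 in \<open>auto simp: eventually_at_filter rpow_def powr_diff\<close>)
  then show ?thesis using True by (simp add: has_field_derivative_iff)
qed

text \<open>Chain rule; the factor \<open>p\<close> of the inner derivative cancels the outer
  \<open>1 / p\<close>. Positivity of the sum keeps the outer power differentiable.\<close>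

lemma has_real_derivative_pnorm_coordinate:
  assumes p: "1 \<le> p" "p = 1 \<longrightarrow> x \<noteq> 0" and S: "0 < C + rpow \<bar>x\<bar> p"
  shows "((\<lambda>y. (C + rpow \<bar>y\<bar> p) powr (1 / p)) has_real_derivative
     rpow (C + rpow \<bar>x\<bar> p) (1 / p - 1) * rpow \<bar>x\<bar> (p - 1) * sgn x) (at x)"
proof -
  have "((\<lambda>y. C + rpow \<bar>y\<bar> p) has_real_derivative 0 + p * rpow \<bar>x\<bar> (p - 1) * sgn x) (at x)"
    by (intro DERIV_add DERIV_const has_real_derivative_rpow_abs p)
  from DERIV_chain2[OF has_real_derivative_powr[OF S, of "1 / p"] this]
  have "((\<lambda>y. (C + rpow \<bar>y\<bar> p) powr (1 / p)) has_real_derivative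
     1 / p * (C + rpow \<bar>x\<bar> p) powr (1 / p - 1) * (0 + p * rpow \<bar>x\<bar> (p - 1) * sgn x)) (at x)" .
  moreover have "(C + rpow \<bar>x\<bar> p) powr (1 / p - 1) = rpow (C + rpow \<bar>x\<bar> p) (1 / p - 1)"
    using S by (auto simp: rpow_def)
  moreover have "1 / p * X * (0 + p * Y * Z) = X * Y * Z" for X Y Z
    using p(1) by simp
  ultimately show ?thesis by simp
qed

text \<open>The convention \<open>rpow 0 0 = 1\<close> makes this hold for \<open>x = 0\<close> and
  \<open>m = 0\<close>, so that the zeroth power is the constant 1.\<close>

lemma rpow_realpow: "0 \<le> x \<Longrightarrow> rpow x (real m) = x ^ m"
  by (cases "x = 0") (auto simp: rpow_def powr_realpow zero_power)

lemma rpow_rpow: "0 \<le> x \<Longrightarrow> rpow (rpow x a) b = rpow x (a * b)"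
  by (auto simp: rpow_def powr_powr)

lemma rpow_nonneg [simp]: "0 \<le> rpow x a"
  by (simp add: rpow_def)

lemma rpow_measurable [measurable]: "(\<lambda>x. rpow x a) \<in> borel_measurable borel"
  unfolding rpow_def by measurable

section \<open>Rational powers, roots and Jacobians of the mode maps\<close>

context haar_matrix
begin

lemma conj_diag_cong: "(\<And>l. l < n \<Longrightarrow> f l = g l) \<Longrightarrow> conj_diag f = conj_diag g"
  by (intro eq_matI) (auto simp: conj_diag_index)

lemma smult_conj_diag: "a \<cdot>\<^sub>m conj_diag f = conj_diag (\<lambda>l. a * f l)"
  by (intro eq_matI) (auto simp: conj_diag_index sum_distrib_left algebra_simps)

lemma galerkin_power_modes_of: "galerkin_power A m (modes_of f) = modes_of (\<lambda>l. f l ^ m)"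
  by (simp add: galerkin_power_eq cong: modes_of_cong)

lemma galerkin_root_modes_of:
  assumes "0 < m" "\<And>l. l < n \<Longrightarrow> 0 \<le> f l"
  shows "galerkin_root A m (modes_of f) = modes_of (\<lambda>l. rpow (f l) (1 / real m))"
proof (rule galerkin_root_eqI)
  fix l assume l: "l < n"
  have "rpow (f l) (1 / real m) ^ m = rpow (rpow (f l) (1 / real m)) (real m)"
    by (simp add: rpow_realpow)
  also have "\<dots> = f l" using assms l rpow_realpow[of "f l" 1] by (simp add: rpow_rpow)
  finally show "0 \<le> rpow (f l) (1 / real m) \<and> rpow (f l) (1 / real m) ^ m = cell_val A (modes_of f) l"
    using l by simp
qed (use assms in auto)

text \<open>Together with \<open>galerkin_power_root\<close> this shows that the Galerkin
  construction of a rational power depends neither on the fraction representing the exponent nor on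
  the order of root and power.\<close>

lemma galerkin_root_power:
  assumes "0 < k" "\<And>l. l < n \<Longrightarrow> 0 \<le> f l"
  shows "galerkin_root A k (galerkin_power A m (modes_of f)) = modes_of (\<lambda>l. rpow (f l) (real m / real k))"
proof -
  have "galerkin_root A k (galerkin_power A m (modes_of f)) = modes_of (\<lambda>l. rpow (f l ^ m) (1 / real k))"
    unfolding galerkin_power_modes_of using assms by (intro galerkin_root_modes_of) auto
  also have "\<dots> = modes_of (\<lambda>l. rpow (f l) (real m / real k))"
    using assms by (intro modes_of_cong) (simp add: rpow_realpow[symmetric] rpow_rpow)
  finally show ?thesis .
qed

lemma galerkin_power_root:
  assumes "0 < k" "\<And>l. l < n \<Longrightarrow> 0 \<le> f l"
  shows "galerkin_power A m (galerkin_root A k (modes_of f)) = modes_of (\<lambda>l. rpow (f l) (real m / real k))"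
proof -
  have "galerkin_root A k (modes_of f) = modes_of (\<lambda>l. rpow (f l) (1 / real k))"
    using assms by (intro galerkin_root_modes_of) auto
  then show ?thesis
    unfolding galerkin_power_modes_of
    using assms by (auto intro!: modes_of_cong simp: galerkin_power_modes_of rpow_realpow[symmetric] rpow_rpow)
qed

text \<open>Realises the absolute value by Galerkin operations alone, as the square root of the
  square. It applies to modes of any sign, since squares have nonnegative cell values.\<close>

lemma galerkin_root_square:
  assumes "u \<in> carrier_vec n"
  shows "galerkin_root A 2 (galerkin_power A 2 u) = modes_of (\<lambda>l. \<bar>cell_val A u l\<bar>)"
  by (rule galerkin_root_eqI) (auto simp: galerkin_power_eq)

lemma has_jacobian_modes_pow:
  assumes "0 \<le> \<gamma>" "u \<in> psd_modes A"
    and "0 < \<gamma> \<and> \<gamma> < 1 \<longrightarrow> (\<forall>l<n. haar_D A u $$ (l, l) \<noteq> 0)"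
  shows "has_jacobian (modes_pow A \<gamma>)
    (\<gamma> \<cdot>\<^sub>m (haar_H A * diag_fun (\<lambda>x. rpow x (\<gamma> - 1)) (haar_D A u) * transpose_mat (haar_H A)))
    (psd_modes A) u"
  unfolding conj_diag_fun smult_conj_diag
  by (rule has_jacobian_conj_diag[where T = "\<lambda>_. {0..}" and \<phi> = "\<lambda>_ y. rpow y \<gamma>"])
    (use assms in \<open>auto simp: psd_modes_iff modes_pow_eq haar_D_index intro!: has_real_derivative_rpow\<close>)

lemma has_jacobian_modes_abs:
  assumes "u \<in> carrier_vec n" "\<forall>l<n. haar_D A u $$ (l, l) \<noteq> 0"
  shows "has_jacobian (modes_abs A)
    (haar_H A * diag_fun sgn (haar_D A u) * transpose_mat (haar_H A)) (carrier_vec n) u"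
  unfolding conj_diag_fun
  by (rule has_jacobian_conj_diag[where T = "\<lambda>_. UNIV" and \<phi> = "\<lambda>_ y. \<bar>y\<bar>"])
    (use assms in \<open>auto simp: modes_abs_eq haar_D_index intro!: has_real_derivative_abs\<close>)

text \<open>With the other components frozen in \<open>C\<close>, each cell value of the norm is a
  function of one real variable. The hypothesis \<open>c\<close> avoids the singularity of the norm
  where all components vanish in a cell, and \<open>p1\<close> avoids the kink of the absolute
  value.\<close>

lemma has_jacobian_modes_norm:
  assumes p: "1 \<le> p" and us: "\<And>j. j \<in> {1..d} \<Longrightarrow> us j \<in> carrier_vec n" and i: "i \<in> {1..d}"
    and c: "\<forall>l<n. haar_D A (modes_c A p d us) $$ (l, l) \<noteq> 0"
    and p1: "p = 1 \<longrightarrow> (\<forall>l<n. haar_D A (us i) $$ (l, l) \<noteq> 0)"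
  shows "has_jacobian (\<lambda>v. modes_norm A p d (us(i := v)))
    (haar_H A
      * (diag_fun (\<lambda>x. rpow x (1 / p - 1)) (haar_D A (modes_c A p d us))
         * diag_fun (\<lambda>x. rpow \<bar>x\<bar> (p - 1)) (haar_D A (us i))
         * haar_D A (modes_sign A (us i)))
      * transpose_mat (haar_H A))
    (carrier_vec n) (us i)"
proof -
  define C where "C l = (\<Sum>j\<in>{1..d} - {i}. \<bar>cell_val A (us j) l\<bar> powr p)" for l
  have sum: "(\<Sum>j=1..d. rpow \<bar>cell_val A (us j) l\<bar> p) = C l + rpow \<bar>cell_val A (us i) l\<bar> p" for l
  proof -
    have "(\<Sum>j=1..d. rpow \<bar>cell_val A (us j) l\<bar> p)
        = rpow \<bar>cell_val A (us i) l\<bar> p + (\<Sum>j\<in>{1..d} - {i}. rpow \<bar>cell_val A (us j) l\<bar> p)"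
      by (rule sum.remove) (use i in auto)
    then show ?thesis using p by (simp add: C_def rpow_def)
  qed
  have cl: "cell_val A (modes_c A p d us) l = C l + rpow \<bar>cell_val A (us i) l\<bar> p" if "l < n" for l
    using that by (simp only: modes_c_eq cell_val_modes_of sum)
  have "haar_H A
      * (diag_fun (\<lambda>x. rpow x (1 / p - 1)) (haar_D A (modes_c A p d us))
         * diag_fun (\<lambda>x. rpow \<bar>x\<bar> (p - 1)) (haar_D A (us i))
         * haar_D A (modes_sign A (us i)))
      * transpose_mat (haar_H A)
    = conj_diag (\<lambda>l. rpow (cell_val A (modes_c A p d us) l) (1 / p - 1)
        * rpow \<bar>cell_val A (us i) l\<bar> (p - 1) * cell_val A (modes_sign A (us i)) l)"
    unfolding diag_fun_haar_D haar_D_eq[of "modes_sign A (us i)"] mat_diag_diag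
    by (simp add: conj_diag_def)
  also have "\<dots> = conj_diag (\<lambda>l. rpow (C l + rpow \<bar>cell_val A (us i) l\<bar> p) (1 / p - 1)
        * rpow \<bar>cell_val A (us i) l\<bar> (p - 1) * sgn (cell_val A (us i) l))"
    by (intro conj_diag_cong) (simp add: cl modes_sign_eq)
  also have "has_jacobian (\<lambda>v. modes_norm A p d (us(i := v))) \<dots> (carrier_vec n) (us i)"
  proof (rule has_jacobian_conj_diag[where T = "\<lambda>_. UNIV" and \<phi> = "\<lambda>l y. (C l + rpow \<bar>y\<bar> p) powr (1 / p)"])
    fix v l assume "l < n"
    then have "cell_val A (modes_norm A p d (us(i := v))) l
        = pnorm p d (\<lambda>j. cell_val A ((us(i := v)) j) l)"
      by (simp add: modes_norm_eq[OF p])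
    also have "\<dots> = (C l + rpow \<bar>cell_val A v l\<bar> p) powr (1 / p)"
      unfolding pnorm_coordinate[OF p i] C_def by simp
    finally show "cell_val A v l \<in> UNIV \<and> cell_val A (modes_norm A p d (us(i := v))) l
        = (C l + rpow \<bar>cell_val A v l\<bar> p) powr (1 / p)" by simp
  next
    fix l assume l: "l < n"
    have "0 \<le> C l" by (simp add: C_def sum_nonneg)
    moreover have "C l + rpow \<bar>cell_val A (us i) l\<bar> p \<noteq> 0"
      using c l by (simp add: haar_D_index cl)
    ultimately have "0 < C l + rpow \<bar>cell_val A (us i) l\<bar> p"
      using rpow_nonneg[of "\<bar>cell_val A (us i) l\<bar>" p] by linarith
    then show "((\<lambda>y. (C l + rpow \<bar>y\<bar> p) powr (1 / p)) has_real_derivative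
        rpow (C l + rpow \<bar>cell_val A (us i) l\<bar> p) (1 / p - 1)
          * rpow \<bar>cell_val A (us i) l\<bar> (p - 1) * sgn (cell_val A (us i) l))
        (at (cell_val A (us i) l) within UNIV)"
      using p p1 l by (intro has_real_derivative_pnorm_coordinate) (auto simp: haar_D_index)
  qed (use us i in \<open>auto simp: modes_norm_eq[OF p]\<close>)
  finally show ?thesis .
qed

end

section \<open>Convergence of modes\<close>

text \<open>The constant \<open>C\<close> and the function \<open>w\<close> may depend on
  \<open>\<epsilon>\<close> but not on \<open>k\<close>: first \<open>w\<close> is made small, then
  \<open>k\<close> is taken large enough to absorb \<open>C\<close>.\<close>

lemma integral_tendsto_zero:
  fixes h q :: "nat \<Rightarrow> 'a \<Rightarrow> real"
  assumes h: "\<And>k. integrable N (h k)" "\<And>k. AE x in N. 0 \<le> h k x"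
    and q: "\<And>k. integrable N (q k)" "(\<lambda>k. \<integral>x. q k x \<partial>N) \<longlonglongrightarrow> 0"
    and dom: "\<And>\<epsilon>. 0 < \<epsilon> \<Longrightarrow> \<exists>w C. integrable N w \<and> (\<integral>x. w x \<partial>N) \<le> \<epsilon> \<and> (\<forall>k. AE x in N. h k x \<le> w x + C * q k x)"
  shows "(\<lambda>k. \<integral>x. h k x \<partial>N) \<longlonglongrightarrow> 0"
proof (rule LIMSEQ_I)
  fix r :: real assume "0 < r"
  then obtain w C where w: "integrable N w" "(\<integral>x. w x \<partial>N) \<le> r / 2"
    "\<And>k. AE x in N. h k x \<le> w x + C * q k x"
    using dom[of "r / 2"] by auto
  have "(\<lambda>k. C * (\<integral>x. q k x \<partial>N)) \<longlonglongrightarrow> C * 0"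
    by (intro tendsto_mult tendsto_const q)
  then obtain k0 where k0: "\<And>k. k \<ge> k0 \<Longrightarrow> \<bar>C * (\<integral>x. q k x \<partial>N)\<bar> < r / 2"
    using LIMSEQ_D[of _ 0 "r / 2"] \<open>0 < r\<close> by fastforce
  have "norm ((\<integral>x. h k x \<partial>N) - 0) < r" if "k \<ge> k0" for k
  proof -
    have "(\<integral>x. h k x \<partial>N) \<le> (\<integral>x. w x + C * q k x \<partial>N)"
      using w q h by (intro integral_mono_AE) auto
    also have "\<dots> = (\<integral>x. w x \<partial>N) + C * (\<integral>x. q k x \<partial>N)"
      using w q by simp
    finally show ?thesis
      using k0[OF that] w(2) integral_nonneg_AE[OF h(2)[of k]] by simp
  qed
  then show "\<exists>k0. \<forall>k\<ge>k0. norm ((\<integral>x. h k x \<partial>N) - 0) < r" by blast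
qed

lemma integrable_bound_AE:
  fixes f w :: "'a \<Rightarrow> real"
  assumes "integrable N w" "f \<in> borel_measurable N" "AE x in N. \<bar>f x\<bar> \<le> w x"
  shows "integrable N f"
proof (rule Bochner_Integration.integrable_bound[OF assms(1,2)])
  show "AE x in N. norm (f x) \<le> norm (w x)" using assms(3) by eventually_elim auto
qed

lemma integrable_square_diff:
  fixes f g :: "'a \<Rightarrow> real"
  assumes "f \<in> borel_measurable N" "g \<in> borel_measurable N"
    "integrable N (\<lambda>x. (f x)\<^sup>2)" "integrable N (\<lambda>x. (g x)\<^sup>2)"
  shows "integrable N (\<lambda>x. (f x - g x)\<^sup>2)"
proof (rule integrable_bound_AE[of _ "\<lambda>x. 2 * (f x)\<^sup>2 + 2 * (g x)\<^sup>2"])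
  have "(f x - g x)\<^sup>2 \<le> 2 * (f x)\<^sup>2 + 2 * (g x)\<^sup>2" for x
    using zero_le_power2[of "f x + g x"] by (simp add: power2_eq_square algebra_simps)
  then show "AE x in N. \<bar>(f x - g x)\<^sup>2\<bar> \<le> 2 * (f x)\<^sup>2 + 2 * (g x)\<^sup>2" by simp
qed (use assms in auto)

section \<open>Integrability and almost sure values of expansions\<close>

context haar_matrix
begin

lemma integrable_cell: "integrable unif01 (\<lambda>x. f (cell n x) :: real)"
proof (rule integrable_bound_AE)
  show "integrable unif01 (\<lambda>x. \<Sum>l<n. \<bar>f l\<bar>)" by simp
  show "AE x in unif01. \<bar>f (cell n x)\<bar> \<le> (\<Sum>l<n. \<bar>f l\<bar>)"
    using AE_unif01_cell[OF pos] by eventually_elim (auto intro!: member_le_sum)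
qed measurable

lemma integrable_expansion:
  assumes "(\<lambda>y. f y) \<in> borel_measurable borel"
  shows "integrable unif01 (\<lambda>x. f (expansion A u x) :: real)"
proof (rule integrable_cong_AE_imp)
  show "integrable unif01 (\<lambda>x. f (cell_val A u (cell n x)))" by (rule integrable_cell)
  show "AE x in unif01. f (cell_val A u (cell n x)) = f (expansion A u x)"
    using AE_expansion by eventually_elim simp
qed (use assms in measurable)

lemma AE_expansion_modes_of: "AE x in unif01. expansion A (modes_of f) x = f (cell n x)"
  using AE_expansion by eventually_elim simp

text \<open>\<open>N\<close> acts on a family so that norms of vectors are covered; a scalar
  function is obtained from a constant family by reading the entry at index 0.\<close>

lemma AE_expansion_map:
  assumes "\<And>l. l < n \<Longrightarrow> f l = N (\<lambda>i. cell_val A (us i) l)"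
  shows "AE x in unif01. expansion A (modes_of f) x = N (\<lambda>i. expansion A (us i) x)"
  using AE_expansion by eventually_elim (simp add: assms)

lemma AE_expansion_nonneg_iff:
  "(AE x in unif01. 0 \<le> expansion A u x) \<longleftrightarrow> (\<forall>l<n. 0 \<le> cell_val A u l)"
proof -
  have "(AE x in unif01. 0 \<le> expansion A u x) \<longleftrightarrow> (AE x in unif01. 0 \<le> cell_val A u (cell n x))"
  proof
    assume "AE x in unif01. 0 \<le> expansion A u x"
    with AE_expansion show "AE x in unif01. 0 \<le> cell_val A u (cell n x)" by eventually_elim simp
  next
    assume "AE x in unif01. 0 \<le> cell_val A u (cell n x)"
    with AE_expansion show "AE x in unif01. 0 \<le> expansion A u x" by eventually_elim simp
  qed
  then show ?thesis using AE_cell_iff[OF pos, of "\<lambda>l. 0 \<le> cell_val A u l"] by (simp only:)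
qed

end

lemma norm_P_tendsto_zero_iff:
  "(\<lambda>k. norm_P (f k)) \<longlonglongrightarrow> 0 \<longleftrightarrow> (\<lambda>k. LINT x|unif01. (f k x)\<^sup>2) \<longlonglongrightarrow> 0"
proof -
  have sq: "norm_P (f k) = sqrt (LINT x|unif01. (f k x)\<^sup>2)" for k
    by (simp add: norm_P_def inner_P_def power2_eq_square)
  have sq': "(LINT x|unif01. (f k x)\<^sup>2) = (norm_P (f k))\<^sup>2" for k
    by (simp add: sq)
  show ?thesis
  proof
    assume "(\<lambda>k. norm_P (f k)) \<longlonglongrightarrow> 0"
    then have "(\<lambda>k. (norm_P (f k))\<^sup>2) \<longlonglongrightarrow> 0\<^sup>2" by (rule tendsto_power)
    then show "(\<lambda>k. LINT x|unif01. (f k x)\<^sup>2) \<longlonglongrightarrow> 0" by (simp add: sq')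
  next
    assume "(\<lambda>k. LINT x|unif01. (f k x)\<^sup>2) \<longlonglongrightarrow> 0"
    then show "(\<lambda>k. norm_P (f k)) \<longlonglongrightarrow> 0" unfolding sq using tendsto_real_sqrt by fastforce
  qed
qed

lemma gpc_modes_iff: "gpc_modes Q c g \<longleftrightarrow> g \<in> borel_measurable borel \<and> integrable unif01 (\<lambda>x. (g x)\<^sup>2)
    \<and> (\<forall>k. c k \<in> carrier_vec (k + 1))
    \<and> (\<lambda>k. LINT x|unif01. (expansion (haar_type k (Q k)) (c k) x - g x)\<^sup>2) \<longlonglongrightarrow> 0"
  by (simp add: gpc_modes_def norm_P_tendsto_zero_iff)

text \<open>If the signs differ then \<open>a\<close> lies at distance at least
  \<open>\<bar>b\<bar> \<ge> \<delta>\<close> from \<open>b\<close>, whereas the squared difference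
  of two signs never exceeds 4.\<close>

lemma sgn_diff_square_le:
  fixes a b \<delta> :: real assumes "0 < \<delta>" "\<delta> \<le> \<bar>b\<bar>"
  shows "(sgn a - sgn b)\<^sup>2 \<le> 4 / \<delta>\<^sup>2 * (a - b)\<^sup>2"
proof (cases "sgn a = sgn b")
  case False
  then have "\<delta> \<le> \<bar>a - b\<bar>" using assms by (auto simp: sgn_if split: if_splits)
  then have "\<delta>\<^sup>2 \<le> (a - b)\<^sup>2" using assms(1) by (simp add: abs_le_square_iff[symmetric])
  then have "4 \<le> 4 / \<delta>\<^sup>2 * (a - b)\<^sup>2" using assms(1) by (simp add: field_simps)
  moreover have "(sgn a - sgn b)\<^sup>2 \<le> 4" by (simp add: sgn_if)
  ultimately show ?thesis by linarith
qed simp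

lemma square_powr: "0 \<le> x \<Longrightarrow> (x powr a)\<^sup>2 = x powr (2 * a)" for x :: real
  by (simp add: power2_eq_square powr_add[symmetric])

text \<open>If \<open>\<bar>a - b\<bar> < \<delta> * b\<close>, factoring out
  \<open>b powr \<gamma>\<close> reduces the claim to continuity of the power at 1. Otherwise
  \<open>a\<close> and \<open>b\<close> are both at most
  \<open>(1 + 1 / \<delta>) * \<bar>a - b\<bar>\<close>, and so the second term alone
  suffices.\<close>

lemma abs_powr_diff_square_le:
  fixes \<gamma> \<epsilon> :: real
  assumes \<gamma>: "0 < \<gamma>" and \<epsilon>: "0 < \<epsilon>"
  obtains C where "\<And>a b. 0 \<le> a \<Longrightarrow> 0 \<le> b \<Longrightarrow>
    (a powr \<gamma> - b powr \<gamma>)\<^sup>2 \<le> \<epsilon> * b powr (2 * \<gamma>) + C * \<bar>a - b\<bar> powr (2 * \<gamma>)"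
proof -
  have "isCont (\<lambda>t. t powr \<gamma>) (1::real)" by (intro continuous_intros) auto
  then obtain \<delta> where \<delta>: "0 < \<delta>" "\<And>t. \<bar>t - 1\<bar> < \<delta> \<Longrightarrow> \<bar>t powr \<gamma> - 1\<bar> < sqrt \<epsilon>"
    using \<epsilon> unfolding continuous_at_eps_delta by (metis dist_real_def powr_one_eq_one real_sqrt_gt_zero)
  let ?L = "1 + 1 / \<delta>"
  have "(a powr \<gamma> - b powr \<gamma>)\<^sup>2 \<le> \<epsilon> * b powr (2 * \<gamma>) + ?L powr (2 * \<gamma>) * \<bar>a - b\<bar> powr (2 * \<gamma>)"
    if ab: "0 \<le> a" "0 \<le> b" for a b
  proof (cases "\<bar>a - b\<bar> < \<delta> * b")
    case True
    then have b: "0 < b" using \<delta> ab by (cases "b = 0") auto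
    have "a / b - 1 = (a - b) / b" using b by (simp add: field_simps)
    then have "\<bar>a / b - 1\<bar> < \<delta>" using True b by (simp add: field_simps)
    then have "\<bar>(a / b) powr \<gamma> - 1\<bar> \<le> sqrt \<epsilon>" using \<delta>(2) by (simp add: less_imp_le)
    then have "((a / b) powr \<gamma> - 1)\<^sup>2 \<le> \<epsilon>"
      using \<epsilon> by (metis abs_le_square_iff abs_of_nonneg real_sqrt_ge_0_iff real_sqrt_pow2 less_imp_le)
    then have "(b powr \<gamma>)\<^sup>2 * ((a / b) powr \<gamma> - 1)\<^sup>2 \<le> (b powr \<gamma>)\<^sup>2 * \<epsilon>"
      by (intro mult_left_mono) auto
    also have "(b powr \<gamma>)\<^sup>2 * ((a / b) powr \<gamma> - 1)\<^sup>2 = (a powr \<gamma> - b powr \<gamma>)\<^sup>2"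
      using ab b by (simp add: power_mult_distrib[symmetric] powr_divide right_diff_distrib)
    finally have "(a powr \<gamma> - b powr \<gamma>)\<^sup>2 \<le> \<epsilon> * b powr (2 * \<gamma>)"
      using ab by (simp add: square_powr mult.commute)
    moreover have "0 \<le> ?L powr (2 * \<gamma>) * \<bar>a - b\<bar> powr (2 * \<gamma>)" by simp
    ultimately show ?thesis by linarith
  next
    case False
    then have "b \<le> \<bar>a - b\<bar> / \<delta>" using \<delta>(1) by (simp add: field_simps)
    moreover have "?L * \<bar>a - b\<bar> = \<bar>a - b\<bar> + \<bar>a - b\<bar> / \<delta>" by (simp add: algebra_simps)
    moreover have "a \<le> b + \<bar>a - b\<bar>" "0 \<le> \<bar>a - b\<bar> / \<delta>" using \<delta>(1) by auto
    ultimately have le: "a \<le> ?L * \<bar>a - b\<bar>" "b \<le> ?L * \<bar>a - b\<bar>" by linarith+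
    let ?m = "(?L * \<bar>a - b\<bar>) powr \<gamma>"
    have "a powr \<gamma> \<le> ?m" "b powr \<gamma> \<le> ?m"
      using le ab \<gamma> by (auto intro: powr_mono2)
    moreover have "0 \<le> a powr \<gamma>" "0 \<le> b powr \<gamma>" by auto
    ultimately have "\<bar>a powr \<gamma> - b powr \<gamma>\<bar> \<le> \<bar>?m\<bar>" by linarith
    then have "(a powr \<gamma> - b powr \<gamma>)\<^sup>2 \<le> ?m\<^sup>2" by (rule iffD1[OF abs_le_square_iff])
    also have "\<dots> = ?L powr (2 * \<gamma>) * \<bar>a - b\<bar> powr (2 * \<gamma>)"
      using \<delta>(1) by (subst square_powr) (simp_all add: powr_mult)
    also have "\<dots> \<le> \<epsilon> * b powr (2 * \<gamma>) + \<dots>" using \<epsilon> by simp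
    finally show ?thesis .
  qed
  then show thesis by (rule that)
qed

text \<open>The threshold \<open>\<eta>\<close> is chosen with
  \<open>\<eta> powr (2 * \<gamma>) = \<epsilon>\<close>; beyond it the nonpositive exponent
  \<open>2 * \<gamma> - 2\<close> bounds the quotient by the square. Under a probability measure
  this lets mean-square convergence imply convergence of the integrals with exponent
  \<open>2 * \<gamma>\<close>.\<close>

lemma abs_powr_le_square:
  fixes \<gamma> \<epsilon> :: real
  assumes \<gamma>: "0 < \<gamma>" "\<gamma> \<le> 1" and \<epsilon>: "0 < \<epsilon>"
  obtains C where "\<And>x. \<bar>x\<bar> powr (2 * \<gamma>) \<le> \<epsilon> + C * x\<^sup>2"
proof -
  define \<eta> where "\<eta> = \<epsilon> powr (1 / (2 * \<gamma>))"
  have \<eta>: "0 < \<eta>" "\<eta> powr (2 * \<gamma>) = \<epsilon>" using \<gamma> \<epsilon> by (auto simp: \<eta>_def powr_powr)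
  have "\<bar>x\<bar> powr (2 * \<gamma>) \<le> \<epsilon> + \<eta> powr (2 * \<gamma> - 2) * x\<^sup>2" for x
  proof (cases "\<bar>x\<bar> \<le> \<eta>")
    case True
    then have "\<bar>x\<bar> powr (2 * \<gamma>) \<le> \<epsilon>" unfolding \<eta>(2)[symmetric] using \<gamma> by (intro powr_mono2) auto
    moreover have "0 \<le> \<eta> powr (2 * \<gamma> - 2) * x\<^sup>2" by simp
    ultimately show ?thesis by linarith
  next
    case False
    then have "x \<noteq> 0" using \<eta> by auto
    have "\<bar>x\<bar> powr (2 * \<gamma>) = \<bar>x\<bar> powr (2 * \<gamma> - 2) * \<bar>x\<bar> powr (real 2)"
      by (subst powr_add[symmetric]) simp
    also have "\<bar>x\<bar> powr (real 2) = x\<^sup>2" using \<open>x \<noteq> 0\<close> by (subst powr_realpow) auto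
    also have "\<bar>x\<bar> powr (2 * \<gamma> - 2) * x\<^sup>2 \<le> \<eta> powr (2 * \<gamma> - 2) * x\<^sup>2"
      using False \<eta> \<gamma> by (intro mult_right_mono powr_mono2') auto
    finally show ?thesis using \<epsilon> by linarith
  qed
  then show thesis by (rule that)
qed

section \<open>Limits of modes along a sequence of Haar-type matrices\<close>

locale haar_sequence =
  fixes Q :: "nat \<Rightarrow> real mat"
  assumes orthonormal: "\<And>k. orthonormal_mat k (Q k)"
begin

abbreviation H :: "nat \<Rightarrow> real mat" where
  "H k \<equiv> haar_type k (Q k)"

abbreviation modes :: "nat \<Rightarrow> (nat \<Rightarrow> real) \<Rightarrow> real vec" where
  "modes k \<equiv> haar_matrix.modes_of (H k) (k + 1)"

lemma haar_matrix_H: "haar_matrix (H k) (k + 1)"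
  by (rule haar_matrix_haar_type[OF orthonormal])

lemma integrable_expansion_H:
  "f \<in> borel_measurable borel \<Longrightarrow> integrable unif01 (\<lambda>x. f (expansion (H k) u x) :: real)"
  by (rule haar_matrix.integrable_expansion[OF haar_matrix_H])

text \<open>By Cauchy-Schwarz the squared error is at most \<open>d\<close> times the sum of the
  squared errors of the components, so \<open>w = 0\<close> works in
  \<open>integral_tendsto_zero\<close>. \<open>N0\<close> gives square integrability of the limit by
  comparison with the zero vector.\<close>

lemma gpc_modes_lipschitz:
  fixes d :: nat
  assumes lip: "\<And>a b. \<bar>N a - N b\<bar> \<le> (\<Sum>i=1..d. \<bar>a i - b i\<bar>)" and N0: "N (\<lambda>_. 0) = 0"
    and c: "\<And>i. i \<in> {1..d} \<Longrightarrow> gpc_modes Q (c i) (g i)"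
    and meas: "(\<lambda>x. N (\<lambda>i. g i x)) \<in> borel_measurable borel"
  shows "gpc_modes Q (\<lambda>k. modes k (\<lambda>l. N (\<lambda>i. cell_val (H k) (c i k) l))) (\<lambda>x. N (\<lambda>i. g i x))"
proof -
  let ?c = "\<lambda>k. modes k (\<lambda>l. N (\<lambda>i. cell_val (H k) (c i k) l))"
  have sq: "(N a - N b)\<^sup>2 \<le> real d * (\<Sum>i=1..d. (a i - b i)\<^sup>2)" for a b
  proof -
    have "(N a - N b)\<^sup>2 \<le> (\<Sum>i=1..d. \<bar>a i - b i\<bar>)\<^sup>2"
      using lip[of a b] by (metis abs_ge_zero abs_le_square_iff abs_of_nonneg order_trans)
    also have "\<dots> \<le> (\<Sum>i=1..d. \<bar>a i - b i\<bar>\<^sup>2) * real (card {1..d})"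
      by (rule sum_squared_le_sum_of_squares)
    finally show ?thesis by (simp add: mult.commute)
  qed
  have g: "\<And>i. i \<in> {1..d} \<Longrightarrow> g i \<in> borel_measurable borel"
    "\<And>i. i \<in> {1..d} \<Longrightarrow> integrable unif01 (\<lambda>x. (g i x)\<^sup>2)"
    "\<And>i. i \<in> {1..d} \<Longrightarrow> (\<lambda>k. LINT x|unif01. (expansion (H k) (c i k) x - g i x)\<^sup>2) \<longlonglongrightarrow> 0"
    using c unfolding gpc_modes_iff by auto
  have int: "integrable unif01 (\<lambda>x. (N (\<lambda>i. g i x))\<^sup>2)"
  proof (rule integrable_bound_AE)
    show "integrable unif01 (\<lambda>x. real d * (\<Sum>i=1..d. (g i x)\<^sup>2))" using g by auto
    show "AE x in unif01. \<bar>(N (\<lambda>i. g i x))\<^sup>2\<bar> \<le> real d * (\<Sum>i=1..d. (g i x)\<^sup>2)"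
      using sq[of _ "\<lambda>_. 0"] by (simp add: N0)
  qed (use meas in measurable)
  have int_diff: "integrable unif01 (\<lambda>x. (expansion (H k) (c i k) x - g i x)\<^sup>2)" if "i \<in> {1..d}" for i k
    using g that by (intro integrable_square_diff integrable_expansion_H) auto
  have "(\<lambda>k. LINT x|unif01. (expansion (H k) (?c k) x - N (\<lambda>i. g i x))\<^sup>2) \<longlonglongrightarrow> 0"
  proof (rule integral_tendsto_zero[where q = "\<lambda>k x. \<Sum>i=1..d. (expansion (H k) (c i k) x - g i x)\<^sup>2"])
    show "integrable unif01 (\<lambda>x. (expansion (H k) (?c k) x - N (\<lambda>i. g i x))\<^sup>2)" for k
      using meas int by (intro integrable_square_diff integrable_expansion_H) auto
    show "integrable unif01 (\<lambda>x. \<Sum>i=1..d. (expansion (H k) (c i k) x - g i x)\<^sup>2)" for k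
      using int_diff by auto
    have "(\<lambda>k. \<Sum>i=1..d. LINT x|unif01. (expansion (H k) (c i k) x - g i x)\<^sup>2) \<longlonglongrightarrow> 0"
      using g by (intro tendsto_null_sum) auto
    then show "(\<lambda>k. LINT x|unif01. (\<Sum>i=1..d. (expansion (H k) (c i k) x - g i x)\<^sup>2)) \<longlonglongrightarrow> 0"
      using int_diff by (subst Bochner_Integration.integral_sum) auto
    fix \<epsilon> :: real assume "0 < \<epsilon>"
    have "AE x in unif01. (expansion (H k) (?c k) x - N (\<lambda>i. g i x))\<^sup>2
        \<le> 0 + real d * (\<Sum>i=1..d. (expansion (H k) (c i k) x - g i x)\<^sup>2)" for k
      using haar_matrix.AE_expansion_map[OF haar_matrix_H[of k] refl, of N "\<lambda>i. c i k"]
      by eventually_elim (simp only: sq add_0)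
    then show "\<exists>w C. integrable unif01 w \<and> (LINT x|unif01. w x) \<le> \<epsilon> \<and> (\<forall>k. AE x in unif01.
        (expansion (H k) (?c k) x - N (\<lambda>i. g i x))\<^sup>2
        \<le> w x + C * (\<Sum>i=1..d. (expansion (H k) (c i k) x - g i x)\<^sup>2))"
      using \<open>0 < \<epsilon>\<close> by (intro exI[of _ "\<lambda>_. 0"] exI[of _ "real d"]) auto
  qed auto
  then show ?thesis
    using meas int by (simp add: gpc_modes_iff haar_matrix.modes_of_carrier[OF haar_matrix_H, simplified])
qed

text \<open>The sets where \<open>\<bar>g x\<bar> < 1 / (real m + 1)\<close> decrease to the zero
  set of \<open>g\<close>, which is null by \<open>nz\<close>, so their measures tend to 0. Away
  from such a set the error is controlled by \<open>sgn_diff_square_le\<close>.\<close>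

lemma gpc_modes_sgn:
  assumes c: "gpc_modes Q c g" and nz: "AE x in unif01. g x \<noteq> 0"
  shows "gpc_modes Q (\<lambda>k. modes k (\<lambda>l. sgn (cell_val (H k) (c k) l))) (\<lambda>x. sgn (g x))"
proof -
  let ?c = "\<lambda>k. modes k (\<lambda>l. sgn (cell_val (H k) (c k) l))"
  have g [measurable]: "g \<in> borel_measurable borel" and
    g2: "integrable unif01 (\<lambda>x. (g x)\<^sup>2)"
    "(\<lambda>k. LINT x|unif01. (expansion (H k) (c k) x - g x)\<^sup>2) \<longlonglongrightarrow> 0"
    using c unfolding gpc_modes_iff by auto
  have sgn_le: "(sgn y)\<^sup>2 \<le> 1" for y :: real by (simp add: sgn_if)
  have int: "integrable unif01 (\<lambda>x. (sgn (g x))\<^sup>2)"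
    by (rule integrable_bound_AE[of _ "\<lambda>_. 1"]) (auto simp: sgn_le)
  have "(\<lambda>m. measure unif01 {x. \<bar>g x\<bar> < 1 / (real m + 1)}) \<longlonglongrightarrow> measure unif01 (\<Inter>m. {x. \<bar>g x\<bar> < 1 / (real m + 1)})"
  proof (rule unif01.finite_Lim_measure_decseq)
    show "decseq (\<lambda>m. {x. \<bar>g x\<bar> < 1 / (real m + 1)})"
      by (rule decseq_SucI) (auto elim!: order_less_le_trans simp: field_simps)
  qed auto
  moreover have "measure unif01 (\<Inter>m. {x. \<bar>g x\<bar> < 1 / (real m + 1)}) = 0"
  proof -
    have "g x = 0" if "x \<in> (\<Inter>m. {x. \<bar>g x\<bar> < 1 / (real m + 1)})" for x
    proof (rule ccontr)
      assume "g x \<noteq> 0"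
      then obtain m where "inverse (real (Suc m)) < \<bar>g x\<bar>" using reals_Archimedean[of "\<bar>g x\<bar>"] by auto
      moreover have "\<bar>g x\<bar> < 1 / (real m + 1)" using that by auto
      ultimately show False by (simp add: inverse_eq_divide add.commute)
    qed
    then show ?thesis using nz by (subst unif01.prob_eq_0) (auto elim!: eventually_mono)
  qed
  ultimately have lim: "(\<lambda>m. measure unif01 {x. \<bar>g x\<bar> < 1 / (real m + 1)}) \<longlonglongrightarrow> 0" by simp
  have "(\<lambda>k. LINT x|unif01. (expansion (H k) (?c k) x - sgn (g x))\<^sup>2) \<longlonglongrightarrow> 0"
  proof (rule integral_tendsto_zero[where q = "\<lambda>k x. (expansion (H k) (c k) x - g x)\<^sup>2"])
    show "integrable unif01 (\<lambda>x. (expansion (H k) (?c k) x - sgn (g x))\<^sup>2)" for k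
      using int by (intro integrable_square_diff integrable_expansion_H) auto
    show "integrable unif01 (\<lambda>x. (expansion (H k) (c k) x - g x)\<^sup>2)" for k
      using g2 by (intro integrable_square_diff integrable_expansion_H) auto
    fix \<epsilon> :: real assume "0 < \<epsilon>"
    then have "\<forall>\<^sub>F m in sequentially. measure unif01 {x. \<bar>g x\<bar> < 1 / (real m + 1)} < \<epsilon> / 4"
      using order_tendstoD(2)[OF lim, of "\<epsilon> / 4"] by simp
    then obtain m where m: "measure unif01 {x. \<bar>g x\<bar> < 1 / (real m + 1)} < \<epsilon> / 4"
      by (auto simp: eventually_sequentially)
    let ?\<delta> = "1 / (real m + 1)"
    \<comment> \<open>Two signs differ by at most 2, hence the weight 4, which matches the mass
      below \<open>\<epsilon> / 4\<close> of the exceptional set.\<close>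
    let ?w = "\<lambda>x. 4 * indicator {x. \<bar>g x\<bar> < ?\<delta>} x :: real"
    have "(sgn y - sgn (g x))\<^sup>2 \<le> ?w x + 4 / ?\<delta>\<^sup>2 * (y - g x)\<^sup>2" for x y
    proof (cases "\<bar>g x\<bar> < ?\<delta>")
      case True
      have "(sgn y - sgn (g x))\<^sup>2 \<le> 4" by (simp add: sgn_if)
      moreover have "0 \<le> 4 / ?\<delta>\<^sup>2 * (y - g x)\<^sup>2" by simp
      moreover have "?w x = 4" using True by simp
      ultimately show ?thesis by linarith
    next
      case False
      then have "(sgn y - sgn (g x))\<^sup>2 \<le> 4 / ?\<delta>\<^sup>2 * (y - g x)\<^sup>2"
        by (intro sgn_diff_square_le) auto
      moreover have "?w x = 0" using False by simp
      ultimately show ?thesis by linarith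
    qed
    note pw = this
    have "AE x in unif01. (expansion (H k) (?c k) x - sgn (g x))\<^sup>2
        \<le> ?w x + 4 / ?\<delta>\<^sup>2 * (expansion (H k) (c k) x - g x)\<^sup>2" for k
      using haar_matrix.AE_expansion_map[OF haar_matrix_H[of k] refl, of "\<lambda>v. sgn (v 0)" "\<lambda>_. c k"]
      by eventually_elim (simp only: pw)
    moreover have "integrable unif01 ?w" by (auto simp: less_top[symmetric])
    moreover have "(LINT x|unif01. ?w x) \<le> \<epsilon>" using m by simp
    ultimately show "\<exists>w C. integrable unif01 w \<and> (LINT x|unif01. w x) \<le> \<epsilon> \<and> (\<forall>k. AE x in unif01.
        (expansion (H k) (?c k) x - sgn (g x))\<^sup>2 \<le> w x + C * (expansion (H k) (c k) x - g x)\<^sup>2)"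
      by blast
  qed (use g2 in auto)
  then show ?thesis
    using int by (simp add: gpc_modes_iff haar_matrix.modes_of_carrier[OF haar_matrix_H, simplified])
qed

text \<open>Where \<open>g\<close> is negative, a nonnegative approximation misses it by at least
  \<open>\<bar>g x\<bar>\<close>. The squared negative part thus has an integral bounded by errors
  that tend to 0.\<close>

lemma gpc_modes_limit_nonneg:
  assumes c: "gpc_modes Q c g" and nn: "\<And>k. AE x in unif01. 0 \<le> expansion (H k) (c k) x"
  shows "AE x in unif01. 0 \<le> g x"
proof -
  have g [measurable]: "g \<in> borel_measurable borel" and
    g2: "integrable unif01 (\<lambda>x. (g x)\<^sup>2)"
    "(\<lambda>k. LINT x|unif01. (expansion (H k) (c k) x - g x)\<^sup>2) \<longlonglongrightarrow> 0"
    using c unfolding gpc_modes_iff by auto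
  have int: "integrable unif01 (\<lambda>x. (min (g x) 0)\<^sup>2)"
    by (rule integrable_bound_AE[OF g2(1)]) (auto simp: min_def)
  have "(LINT x|unif01. (min (g x) 0)\<^sup>2) \<le> (LINT x|unif01. (expansion (H k) (c k) x - g x)\<^sup>2)" for k
  proof (rule integral_mono_AE[OF int])
    show "integrable unif01 (\<lambda>x. (expansion (H k) (c k) x - g x)\<^sup>2)"
      using g2 by (intro integrable_square_diff integrable_expansion_H) auto
    show "AE x in unif01. (min (g x) 0)\<^sup>2 \<le> (expansion (H k) (c k) x - g x)\<^sup>2"
      using nn[of k] by eventually_elim (auto simp: min_def abs_le_square_iff[symmetric])
  qed
  then have "(LINT x|unif01. (min (g x) 0)\<^sup>2) \<le> 0"
    by (intro tendsto_lowerbound[OF g2(2)]) auto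
  then have "(LINT x|unif01. (min (g x) 0)\<^sup>2) = 0"
    by (simp add: antisym)
  then have "AE x in unif01. (min (g x) 0)\<^sup>2 = 0"
    using int by (subst (asm) integral_nonneg_eq_0_iff_AE) auto
  then show ?thesis by eventually_elim (auto simp: min_def split: if_splits)
qed

text \<open>The map \<open>x powr \<gamma>\<close> is continuous on nonnegative functions from
  exponent \<open>2 * \<gamma>\<close> to exponent 2. The convergence required at exponent
  \<open>2 * \<gamma>\<close> is supplied by \<open>big\<close> for \<open>\<gamma> > 1\<close> and
  follows from mean-square convergence otherwise.\<close>

lemma gpc_modes_powr:
  assumes \<gamma>: "0 < \<gamma>" and c: "gpc_modes Q c g"
    and nn: "\<And>k. AE x in unif01. 0 \<le> expansion (H k) (c k) x"
    and big: "1 < \<gamma> \<Longrightarrow> integrable unif01 (\<lambda>x. \<bar>g x\<bar> powr (2 * \<gamma>))"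
      "1 < \<gamma> \<Longrightarrow> (\<lambda>k. LINT x|unif01. \<bar>expansion (H k) (c k) x - g x\<bar> powr (2 * \<gamma>)) \<longlonglongrightarrow> 0"
  shows "gpc_modes Q (\<lambda>k. modes k (\<lambda>l. cell_val (H k) (c k) l powr \<gamma>)) (\<lambda>x. g x powr \<gamma>)"
proof -
  let ?c = "\<lambda>k. modes k (\<lambda>l. cell_val (H k) (c k) l powr \<gamma>)"
  let ?f = "\<lambda>k. expansion (H k) (c k)"
  have g [measurable]: "g \<in> borel_measurable borel" and
    g2: "integrable unif01 (\<lambda>x. (g x)\<^sup>2)" "(\<lambda>k. LINT x|unif01. (?f k x - g x)\<^sup>2) \<longlonglongrightarrow> 0"
    using c unfolding gpc_modes_iff by auto
  have g0: "AE x in unif01. 0 \<le> g x" by (rule gpc_modes_limit_nonneg[OF c nn])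
  have small: "integrable unif01 (\<lambda>x. \<bar>f x\<bar> powr (2 * \<gamma>))"
    if f: "\<gamma> \<le> 1" "f \<in> borel_measurable borel" "integrable unif01 (\<lambda>x. (f x)\<^sup>2)" for f
  proof -
    obtain C where C: "\<And>x. \<bar>x\<bar> powr (2 * \<gamma>) \<le> 1 + C * x\<^sup>2"
      using abs_powr_le_square[OF \<gamma> f(1), of 1] by auto
    show ?thesis
      by (rule integrable_bound_AE[of _ "\<lambda>x. 1 + C * (f x)\<^sup>2"]) (use f C in auto)
  qed
  have int_d2: "integrable unif01 (\<lambda>x. (?f k x - g x)\<^sup>2)" for k
    using g2 by (intro integrable_square_diff integrable_expansion_H) auto
  have int_g: "integrable unif01 (\<lambda>x. \<bar>g x\<bar> powr (2 * \<gamma>))"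
    using big(1) small[OF _ g g2(1)] by (cases "\<gamma> \<le> 1") auto
  have int_d: "integrable unif01 (\<lambda>x. \<bar>?f k x - g x\<bar> powr (2 * \<gamma>))" for k
  proof (rule integrable_bound_AE)
    show "integrable unif01 (\<lambda>x. 2 powr (2 * \<gamma>) * (\<bar>?f k x\<bar> powr (2 * \<gamma>) + \<bar>g x\<bar> powr (2 * \<gamma>)))"
      using int_g integrable_expansion_H[of "\<lambda>y. \<bar>y\<bar> powr (2 * \<gamma>)" k] by auto
    have "\<bar>a - b\<bar> powr (2 * \<gamma>) \<le> 2 powr (2 * \<gamma>) * (\<bar>a\<bar> powr (2 * \<gamma>) + \<bar>b\<bar> powr (2 * \<gamma>))" for a b :: real
    proof -
      have "\<bar>a - b\<bar> powr (2 * \<gamma>) \<le> (2 * max \<bar>a\<bar> \<bar>b\<bar>) powr (2 * \<gamma>)"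
        using \<gamma> by (intro powr_mono2) auto
      also have "\<dots> = 2 powr (2 * \<gamma>) * max \<bar>a\<bar> \<bar>b\<bar> powr (2 * \<gamma>)"
        by (rule powr_mult)
      also have "\<dots> \<le> 2 powr (2 * \<gamma>) * (\<bar>a\<bar> powr (2 * \<gamma>) + \<bar>b\<bar> powr (2 * \<gamma>))"
        by (intro mult_left_mono) (auto simp: max_def)
      finally show ?thesis .
    qed
    then show "AE x in unif01. \<bar>\<bar>?f k x - g x\<bar> powr (2 * \<gamma>)\<bar>
        \<le> 2 powr (2 * \<gamma>) * (\<bar>?f k x\<bar> powr (2 * \<gamma>) + \<bar>g x\<bar> powr (2 * \<gamma>))" by simp
  qed measurable
  have lim: "(\<lambda>k. LINT x|unif01. \<bar>?f k x - g x\<bar> powr (2 * \<gamma>)) \<longlonglongrightarrow> 0"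
  proof (cases "1 < \<gamma>")
    case False
    show ?thesis
    proof (rule integral_tendsto_zero[OF int_d _ int_d2 g2(2)])
      fix \<epsilon> :: real assume "0 < \<epsilon>"
      then obtain C where "\<And>x. \<bar>x\<bar> powr (2 * \<gamma>) \<le> \<epsilon> + C * x\<^sup>2"
        using abs_powr_le_square[OF \<gamma>] False by (metis linorder_not_le)
      \<comment> \<open>The constant \<open>\<epsilon>\<close> is an admissible \<open>w\<close>
        because the total mass is 1.\<close>
      then show "\<exists>w C. integrable unif01 w \<and> (LINT x|unif01. w x) \<le> \<epsilon> \<and> (\<forall>k. AE x in unif01.
          \<bar>?f k x - g x\<bar> powr (2 * \<gamma>) \<le> w x + C * (?f k x - g x)\<^sup>2)"
        by (intro exI[of _ "\<lambda>_. \<epsilon>"] exI[of _ C]) (auto simp: unif01.prob_space[simplified])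
    qed simp
  qed (rule big(2))
  have int: "integrable unif01 (\<lambda>x. (g x powr \<gamma>)\<^sup>2)"
  proof (rule integrable_cong_AE_imp[OF int_g])
    show "AE x in unif01. \<bar>g x\<bar> powr (2 * \<gamma>) = (g x powr \<gamma>)\<^sup>2"
      using g0 by eventually_elim (simp add: square_powr)
  qed measurable
  have "(\<lambda>k. LINT x|unif01. (expansion (H k) (?c k) x - g x powr \<gamma>)\<^sup>2) \<longlonglongrightarrow> 0"
  proof (rule integral_tendsto_zero[OF _ _ int_d lim])
    show "integrable unif01 (\<lambda>x. (expansion (H k) (?c k) x - g x powr \<gamma>)\<^sup>2)" for k
      using int by (intro integrable_square_diff integrable_expansion_H) auto
    fix \<epsilon> :: real assume \<epsilon>: "0 < \<epsilon>"
    let ?I = "LINT x|unif01. \<bar>g x\<bar> powr (2 * \<gamma>)"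
    have I: "0 \<le> ?I" by simp
    \<comment> \<open>The summand 1 keeps the denominator positive even if \<open>?I\<close> is 0,
      and still makes the integral of \<open>?w\<close> at most \<open>\<epsilon>\<close>.\<close>
    define \<epsilon>' where "\<epsilon>' = \<epsilon> / (1 + ?I)"
    have \<epsilon>': "0 < \<epsilon>'" unfolding \<epsilon>'_def by (rule divide_pos_pos[OF \<epsilon>]) (use I in linarith)
    obtain C where C: "\<And>a b. 0 \<le> a \<Longrightarrow> 0 \<le> b \<Longrightarrow>
        (a powr \<gamma> - b powr \<gamma>)\<^sup>2 \<le> \<epsilon>' * b powr (2 * \<gamma>) + C * \<bar>a - b\<bar> powr (2 * \<gamma>)"
      using abs_powr_diff_square_le[OF \<gamma> \<epsilon>'] by blast
    let ?w = "\<lambda>x. \<epsilon>' * \<bar>g x\<bar> powr (2 * \<gamma>)"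
    have "AE x in unif01. (expansion (H k) (?c k) x - g x powr \<gamma>)\<^sup>2
        \<le> ?w x + C * \<bar>?f k x - g x\<bar> powr (2 * \<gamma>)" for k
      using haar_matrix.AE_expansion_map[OF haar_matrix_H[of k] refl, of "\<lambda>v. v 0 powr \<gamma>" "\<lambda>_. c k"] g0 nn[of k]
      by eventually_elim (use C in auto)
    moreover have "integrable unif01 ?w" using int_g by simp
    moreover have "(LINT x|unif01. ?w x) \<le> \<epsilon>"
    proof -
      have "(LINT x|unif01. ?w x) = \<epsilon>' * ?I" by simp
      also have "\<dots> \<le> \<epsilon>' * (1 + ?I)" using \<epsilon>' by (intro mult_left_mono) auto
      also have "\<dots> = \<epsilon>"
      proof -
        have "1 + ?I \<noteq> 0" using I by linarith
        then show ?thesis unfolding \<epsilon>'_def by (rule nonzero_eq_divide_eq[THEN iffD1, OF _ refl])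
      qed
      finally show ?thesis .
    qed
    ultimately show "\<exists>w C. integrable unif01 w \<and> (LINT x|unif01. w x) \<le> \<epsilon> \<and> (\<forall>k. AE x in unif01.
        (expansion (H k) (?c k) x - g x powr \<gamma>)\<^sup>2 \<le> w x + C * \<bar>?f k x - g x\<bar> powr (2 * \<gamma>))"
      by blast
  qed auto
  then show ?thesis
    using int by (simp add: gpc_modes_iff haar_matrix.modes_of_carrier[OF haar_matrix_H, simplified])
qed

text \<open>Serves the exponent 0, where \<open>rpow\<close> is constantly 1, also at cells with
  value 0.\<close>

lemma gpc_modes_one: "gpc_modes Q (\<lambda>k. modes k (\<lambda>_. 1)) (\<lambda>_. 1)"
proof -
  have "(LINT x|unif01. (expansion (H k) (modes k (\<lambda>_. 1)) x - 1)\<^sup>2) = 0" for k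
  proof -
    have "AE x in unif01. (expansion (H k) (modes k (\<lambda>_. 1)) x - 1)\<^sup>2 = 0"
      using haar_matrix.AE_expansion_modes_of[OF haar_matrix_H[of k], of "\<lambda>_. 1"] by eventually_elim simp
    then show ?thesis by (rule integral_eq_zero_AE)
  qed
  then show ?thesis
    by (simp add: gpc_modes_iff haar_matrix.modes_of_carrier[OF haar_matrix_H, simplified])
qed

end

context haar_sequence
begin

lemma gpc_modes_pow:
  assumes \<gamma>: "0 \<le> \<gamma>" and c: "gpc_modes Q c g"
    and nn: "\<And>k. AE x in unif01. 0 \<le> expansion (H k) (c k) x"
    and big: "1 < \<gamma> \<Longrightarrow> integrable unif01 (\<lambda>x. \<bar>g x\<bar> powr (2 * \<gamma>))"
      "1 < \<gamma> \<Longrightarrow> (\<lambda>k. LINT x|unif01. \<bar>expansion (H k) (c k) x - g x\<bar> powr (2 * \<gamma>)) \<longlonglongrightarrow> 0"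
  shows "gpc_modes Q (\<lambda>k. modes_pow (H k) \<gamma> (c k)) (\<lambda>x. rpow (g x) \<gamma>)"
proof (cases "\<gamma> = 0")
  case True
  then show ?thesis
    using gpc_modes_one by (simp add: haar_matrix.modes_pow_eq[OF haar_matrix_H] rpow_def)
next
  case False
  then show ?thesis
    using gpc_modes_powr[OF _ c nn big] \<gamma> by (simp add: haar_matrix.modes_pow_eq[OF haar_matrix_H] rpow_def)
qed

lemma gpc_modes_abs:
  assumes c: "gpc_modes Q c g"
  shows "gpc_modes Q (\<lambda>k. modes_abs (H k) (c k)) (\<lambda>x. \<bar>g x\<bar>)"
proof -
  have meas: "g \<in> borel_measurable borel" and cc: "\<And>k. c k \<in> carrier_vec (k + 1)"
    using c by (auto simp: gpc_modes_def)
  have "gpc_modes Q (\<lambda>k. modes k (\<lambda>l. \<bar>cell_val (H k) (c k) l\<bar>)) (\<lambda>x. \<bar>g x\<bar>)"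
    by (rule gpc_modes_lipschitz[where N = "\<lambda>a. \<bar>a 1\<bar>" and d = 1 and c = "\<lambda>_. c" and g = "\<lambda>_. g"])
      (use c meas in auto)
  then show ?thesis by (simp only: haar_matrix.modes_abs_eq[OF haar_matrix_H cc])
qed

lemma gpc_modes_norm1:
  assumes c: "\<And>i. i \<in> {1..d} \<Longrightarrow> gpc_modes Q (c i) (g i)"
  shows "gpc_modes Q (\<lambda>k. modes_norm1 (H k) d (\<lambda>i. c i k)) (\<lambda>x. \<Sum>i=1..d. \<bar>g i x\<bar>)"
  unfolding haar_matrix.modes_norm1_eq[OF haar_matrix_H]
proof (rule gpc_modes_lipschitz[where N = "\<lambda>a. \<Sum>i=1..d. \<bar>a i\<bar>" and d = d and c = c and g = g])
  fix a b :: "nat \<Rightarrow> real"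
  have "\<bar>(\<Sum>i=1..d. \<bar>a i\<bar>) - (\<Sum>i=1..d. \<bar>b i\<bar>)\<bar> \<le> (\<Sum>i=1..d. \<bar>\<bar>a i\<bar> - \<bar>b i\<bar>\<bar>)"
    unfolding sum_subtractf[symmetric] by (rule sum_abs)
  also have "\<dots> \<le> (\<Sum>i=1..d. \<bar>a i - b i\<bar>)" by (intro sum_mono) auto
  finally show "\<bar>(\<Sum>i=1..d. \<bar>a i\<bar>) - (\<Sum>i=1..d. \<bar>b i\<bar>)\<bar> \<le> (\<Sum>i=1..d. \<bar>a i - b i\<bar>)" .
  show "(\<lambda>x. \<Sum>i=1..d. \<bar>g i x\<bar>) \<in> borel_measurable borel"
    using c by (intro borel_measurable_sum borel_measurable_abs) (auto simp: gpc_modes_def)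
qed (use c in auto)

lemma gpc_modes_pnorm:
  assumes p: "1 \<le> p" and c: "\<And>i. i \<in> {1..d} \<Longrightarrow> gpc_modes Q (c i) (g i)"
  shows "gpc_modes Q (\<lambda>k. modes_norm (H k) p d (\<lambda>i. c i k)) (\<lambda>x. pnorm p d (\<lambda>i. g i x))"
  unfolding haar_matrix.modes_norm_eq[OF haar_matrix_H p]
proof (rule gpc_modes_lipschitz[where N = "pnorm p d" and d = d and c = c and g = g])
  have [measurable]: "\<And>i. i \<in> {1..d} \<Longrightarrow> g i \<in> borel_measurable borel"
    using c by (auto simp: gpc_modes_def)
  show "(\<lambda>x. pnorm p d (\<lambda>i. g i x)) \<in> borel_measurable borel"
    unfolding pnorm_def by measurable
  show "\<bar>pnorm p d a - pnorm p d b\<bar> \<le> (\<Sum>i=1..d. \<bar>a i - b i\<bar>)" for a b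
    by (rule pnorm_lipschitz[OF p])
  show "pnorm p d (\<lambda>_. 0) = 0" by (simp add: pnorm_def)
qed (use c in auto)

end

text \<open>Being modes of a nonlinear function is read in two ways: at fixed \<open>K\<close>, as
  agreement with Galerkin operations and with the function of the expansion almost surely; and for
  growing truncation index, as mean-square convergence. The Jacobian conditions avoid eigenvalues at
  which the entrywise functions have a kink or infinite slope.\<close>

theorem theorem3:
  fixes M :: "'w measure" and \<xi> :: "'w \<Rightarrow> real"
    and K :: nat and Q :: "nat \<Rightarrow> real mat" and A :: "real mat"
  assumes "prob_space M" and "\<xi> \<in> borel_measurable M" and "distr M borel \<xi> = unif01"
    and "\<forall>k. orthonormal_mat k (Q k)"
    and "A = haar_type K (Q K)"
  shows
  \<comment> \<open>(i) powers\<close>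
  "((\<forall>\<gamma> u. \<gamma> \<in> \<rat> \<and> 0 \<le> \<gamma> \<and> u \<in> carrier_vec (K + 1)
        \<and> (AE \<omega> in M. 0 \<le> expansion A u (\<xi> \<omega>)) \<longrightarrow>
      (\<forall>m n. 0 < n \<and> \<gamma> = real m / real n \<longrightarrow>
         galerkin_root A n (galerkin_power A m u) = modes_pow A \<gamma> u
       \<and> galerkin_power A m (galerkin_root A n u) = modes_pow A \<gamma> u)
    \<and> (AE \<omega> in M. expansion A (modes_pow A \<gamma> u) (\<xi> \<omega>) = rpow (expansion A u (\<xi> \<omega>)) \<gamma>)
    \<and> ((0 < \<gamma> \<and> \<gamma> < 1 \<longrightarrow> (\<forall>l\<le>K. haar_D A u $$ (l, l) \<noteq> 0)) \<longrightarrow>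
         has_jacobian (modes_pow A \<gamma>)
           (\<gamma> \<cdot>\<^sub>m (haar_H A * diag_fun (\<lambda>x. rpow x (\<gamma> - 1)) (haar_D A u)
                    * transpose_mat (haar_H A)))
           (psd_modes A) u))
   \<and> (\<forall>\<gamma> c g. \<gamma> \<in> \<rat> \<and> 0 \<le> \<gamma> \<and> gpc_modes Q c g
        \<and> (\<forall>k. AE \<omega> in M. 0 \<le> expansion (haar_type k (Q k)) (c k) (\<xi> \<omega>))
        \<and> (1 < \<gamma> \<longrightarrow> integrable unif01 (\<lambda>x. \<bar>g x\<bar> powr (2 * \<gamma>))
             \<and> (\<lambda>k. LINT x|unif01. \<bar>expansion (haar_type k (Q k)) (c k) x - g x\<bar> powr (2 * \<gamma>))
                 \<longlonglongrightarrow> 0) \<longrightarrow>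
      gpc_modes Q (\<lambda>k. modes_pow (haar_type k (Q k)) \<gamma> (c k)) (\<lambda>x. rpow (g x) \<gamma>)))
   \<and>
   \<comment> \<open>(ii) signum function\<close>
   ((\<forall>u \<in> carrier_vec (K + 1).
      AE \<omega> in M. expansion A (modes_sign A u) (\<xi> \<omega>) = sgn (expansion A u (\<xi> \<omega>)))
   \<and> (\<forall>c g. gpc_modes Q c g \<and> (AE \<omega> in M. g (\<xi> \<omega>) \<noteq> 0) \<longrightarrow>
      gpc_modes Q (\<lambda>k. modes_sign (haar_type k (Q k)) (c k)) (\<lambda>x. sgn (g x))))
   \<and>
   \<comment> \<open>(iii) absolute value\<close>
   ((\<forall>u \<in> carrier_vec (K + 1).
      galerkin_root A 2 (galerkin_power A 2 u) = galerkin_prod A (modes_sign A u) u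
    \<and> (AE \<omega> in M. expansion A (galerkin_prod A (modes_sign A u) u) (\<xi> \<omega>)
         = \<bar>expansion A u (\<xi> \<omega>)\<bar>)
    \<and> ((\<forall>l\<le>K. haar_D A u $$ (l, l) \<noteq> 0) \<longrightarrow>
         has_jacobian (\<lambda>v. galerkin_prod A (modes_sign A v) v)
           (haar_H A * diag_fun sgn (haar_D A u) * transpose_mat (haar_H A))
           (carrier_vec (K + 1)) u))
   \<and> (\<forall>c g. gpc_modes Q c g \<longrightarrow>
      gpc_modes Q
        (\<lambda>k. galerkin_prod (haar_type k (Q k)) (modes_sign (haar_type k (Q k)) (c k)) (c k))
        (\<lambda>x. \<bar>g x\<bar>)))
   \<and>
   \<comment> \<open>(iv) norms\<close>
   ((\<forall>d us. (\<forall>i\<in>{1..d}. us i \<in> carrier_vec (K + 1)) \<longrightarrow>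
      sum_modes A d (\<lambda>i. galerkin_root A 2 (galerkin_power A 2 (us i))) = modes_norm1 A d us
    \<and> (AE \<omega> in M. expansion A (modes_norm1 A d us) (\<xi> \<omega>)
         = (\<Sum>i=1..d. \<bar>expansion A (us i) (\<xi> \<omega>)\<bar>)))
   \<and> (\<forall>d c g. (\<forall>i\<in>{1..d}. gpc_modes Q (c i) (g i)) \<longrightarrow>
      gpc_modes Q (\<lambda>k. modes_norm1 (haar_type k (Q k)) d (\<lambda>i. c i k))
        (\<lambda>x. \<Sum>i=1..d. \<bar>g i x\<bar>))
   \<and> (\<forall>p d us. 1 \<le> p \<and> (\<forall>i\<in>{1..d}. us i \<in> carrier_vec (K + 1)) \<longrightarrow>
      (\<forall>m. p = real m \<longrightarrow>
         (\<forall>i\<in>{1..d}. galerkin_power A m (modes_abs A (us i)) = modes_abs_pow A p (us i))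
       \<and> galerkin_root A m (modes_c A p d us) = modes_norm A p d us)
    \<and> (\<forall>m n. 0 < n \<and> p = real m / real n \<longrightarrow>
         (\<forall>i\<in>{1..d}. galerkin_root A n (galerkin_power A m (modes_abs A (us i)))
            = modes_abs_pow A p (us i))
       \<and> galerkin_root A m (galerkin_power A n (modes_c A p d us)) = modes_norm A p d us)
    \<and> (AE \<omega> in M. expansion A (modes_norm A p d us) (\<xi> \<omega>)
         = pnorm p d (\<lambda>i. expansion A (us i) (\<xi> \<omega>)))
    \<and> (\<forall>i\<in>{1..d}. (\<forall>l\<le>K. haar_D A (modes_c A p d us) $$ (l, l) \<noteq> 0)
          \<and> (p = 1 \<longrightarrow> (\<forall>l\<le>K. haar_D A (us i) $$ (l, l) \<noteq> 0)) \<longrightarrow>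
         has_jacobian (\<lambda>v. modes_norm A p d (us(i := v)))
           (haar_H A
             * (diag_fun (\<lambda>x. rpow x (1 / p - 1)) (haar_D A (modes_c A p d us))
                * diag_fun (\<lambda>x. rpow \<bar>x\<bar> (p - 1)) (haar_D A (us i))
                * haar_D A (modes_sign A (us i)))
             * transpose_mat (haar_H A))
           (carrier_vec (K + 1)) (us i)))
   \<and> (\<forall>p d c g. 1 \<le> p \<and> (\<forall>i\<in>{1..d}. gpc_modes Q (c i) (g i)) \<longrightarrow>
      gpc_modes Q (\<lambda>k. modes_norm (haar_type k (Q k)) p d (\<lambda>i. c i k))
        (\<lambda>x. pnorm p d (\<lambda>i. g i x))))"
proof -
  interpret haar_sequence Q by unfold_locales (use assms(4) in auto)
  interpret A: haar_matrix A "K + 1" unfolding assms(5) by (rule haar_matrix_H)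
  have AE: "AE \<omega> in M. P (\<xi> \<omega>)" if "AE x in unif01. P x" for P
    using that assms(2) unfolding assms(3)[symmetric] by (rule AE_distrD[rotated])
  \<comment> \<open>Unlike \<open>AE\<close>, the passage from \<open>M\<close> back to the law of
    \<open>\<xi>\<close> asks for a Borel set.\<close>
  have AE_conv: "AE x in unif01. P x" if "AE \<omega> in M. P (\<xi> \<omega>)" "{x. P x} \<in> sets borel" for P
    using that assms(2) unfolding assms(3)[symmetric] by (subst AE_distr_iff) auto
  have nonneg: "AE x in unif01. 0 \<le> expansion B u x" if "AE \<omega> in M. 0 \<le> expansion B u (\<xi> \<omega>)" for B u
    using that by (rule AE_conv) measurable
  have le: "(\<forall>l\<le>K. P l) \<longleftrightarrow> (\<forall>l<K + 1. P l)" for P :: "nat \<Rightarrow> bool" by auto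
  have pow: "\<forall>\<gamma> u. \<gamma> \<in> \<rat> \<and> 0 \<le> \<gamma> \<and> u \<in> carrier_vec (K + 1)
        \<and> (AE \<omega> in M. 0 \<le> expansion A u (\<xi> \<omega>)) \<longrightarrow>
      (\<forall>m n. 0 < n \<and> \<gamma> = real m / real n \<longrightarrow>
         galerkin_root A n (galerkin_power A m u) = modes_pow A \<gamma> u
       \<and> galerkin_power A m (galerkin_root A n u) = modes_pow A \<gamma> u)
    \<and> (AE \<omega> in M. expansion A (modes_pow A \<gamma> u) (\<xi> \<omega>) = rpow (expansion A u (\<xi> \<omega>)) \<gamma>)
    \<and> ((0 < \<gamma> \<and> \<gamma> < 1 \<longrightarrow> (\<forall>l\<le>K. haar_D A u $$ (l, l) \<noteq> 0)) \<longrightarrow>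
         has_jacobian (modes_pow A \<gamma>)
           (\<gamma> \<cdot>\<^sub>m (haar_H A * diag_fun (\<lambda>x. rpow x (\<gamma> - 1)) (haar_D A u)
                    * transpose_mat (haar_H A)))
           (psd_modes A) u)"
  proof (intro allI impI, elim conjE)
    fix \<gamma> :: real and u :: "real vec"
    assume \<gamma>: "0 \<le> \<gamma>" and u: "u \<in> carrier_vec (K + 1)" and nn: "AE \<omega> in M. 0 \<le> expansion A u (\<xi> \<omega>)"
    have val: "\<And>l. l < K + 1 \<Longrightarrow> 0 \<le> cell_val A u l"
      using nonneg[OF nn] by (simp add: A.AE_expansion_nonneg_iff)
    have "galerkin_root A n (galerkin_power A m u) = modes_pow A \<gamma> u
       \<and> galerkin_power A m (galerkin_root A n u) = modes_pow A \<gamma> u" if "0 < n" "\<gamma> = real m / real n" for m n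
    proof -
      have "galerkin_root A n (galerkin_power A m (A.modes_of (cell_val A u))) = modes_pow A \<gamma> u"
        unfolding A.modes_pow_eq that(2) using that(1) val by (rule A.galerkin_root_power)
      moreover have "galerkin_power A m (galerkin_root A n (A.modes_of (cell_val A u))) = modes_pow A \<gamma> u"
        unfolding A.modes_pow_eq that(2) using that(1) val by (rule A.galerkin_power_root)
      ultimately show ?thesis by (simp only: A.modes_of_cell_val[OF u])
    qed
    moreover have "AE \<omega> in M. expansion A (modes_pow A \<gamma> u) (\<xi> \<omega>) = rpow (expansion A u (\<xi> \<omega>)) \<gamma>"
      unfolding A.modes_pow_eq by (rule AE, rule A.AE_expansion_map[where us = "\<lambda>_. u" and N = "\<lambda>v. rpow (v 0) \<gamma>"]) simp
    moreover have "u \<in> psd_modes A" using u val by (simp add: A.psd_modes_iff)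
    ultimately show "(\<forall>m n. 0 < n \<and> \<gamma> = real m / real n \<longrightarrow>
         galerkin_root A n (galerkin_power A m u) = modes_pow A \<gamma> u
       \<and> galerkin_power A m (galerkin_root A n u) = modes_pow A \<gamma> u)
    \<and> (AE \<omega> in M. expansion A (modes_pow A \<gamma> u) (\<xi> \<omega>) = rpow (expansion A u (\<xi> \<omega>)) \<gamma>)
    \<and> ((0 < \<gamma> \<and> \<gamma> < 1 \<longrightarrow> (\<forall>l\<le>K. haar_D A u $$ (l, l) \<noteq> 0)) \<longrightarrow>
         has_jacobian (modes_pow A \<gamma>)
           (\<gamma> \<cdot>\<^sub>m (haar_H A * diag_fun (\<lambda>x. rpow x (\<gamma> - 1)) (haar_D A u)
                    * transpose_mat (haar_H A)))
           (psd_modes A) u)"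
      using A.has_jacobian_modes_pow[OF \<gamma>, of u] unfolding le by blast
  qed
  have sign: "AE \<omega> in M. expansion A (modes_sign A u) (\<xi> \<omega>) = sgn (expansion A u (\<xi> \<omega>))" for u
    unfolding A.modes_sign_eq by (rule AE, rule A.AE_expansion_map[where us = "\<lambda>_. u" and N = "\<lambda>v. sgn (v 0)"]) simp
  have sign_gpc: "gpc_modes Q (\<lambda>k. modes_sign (H k) (c k)) (\<lambda>x. sgn (g x))"
    if "gpc_modes Q c g" "AE \<omega> in M. g (\<xi> \<omega>) \<noteq> 0" for c g
  proof -
    have [measurable]: "g \<in> borel_measurable borel" using that(1) by (simp add: gpc_modes_def)
    have "AE x in unif01. g x \<noteq> 0" using that(2) by (rule AE_conv) measurable
    then show ?thesis
      using gpc_modes_sgn[OF that(1)] by (simp only: haar_matrix.modes_sign_eq[OF haar_matrix_H])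
  qed
  have abs: "galerkin_root A 2 (galerkin_power A 2 u) = modes_abs A u
      \<and> (AE \<omega> in M. expansion A (modes_abs A u) (\<xi> \<omega>) = \<bar>expansion A u (\<xi> \<omega>)\<bar>)"
    if u: "u \<in> carrier_vec (K + 1)" for u
    unfolding A.galerkin_root_square[OF u] A.modes_abs_eq[OF u]
    by (intro conjI refl AE A.AE_expansion_map[where us = "\<lambda>_. u" and N = "\<lambda>v. \<bar>v 0\<bar>"])
  have norm1: "sum_modes A d (\<lambda>i. galerkin_root A 2 (galerkin_power A 2 (us i))) = modes_norm1 A d us
      \<and> (AE \<omega> in M. expansion A (modes_norm1 A d us) (\<xi> \<omega>) = (\<Sum>i=1..d. \<bar>expansion A (us i) (\<xi> \<omega>)\<bar>))"
    if us: "\<forall>i\<in>{1..d}. us i \<in> carrier_vec (K + 1)" for d us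
  proof
    have "sum_modes A d (\<lambda>i. galerkin_root A 2 (galerkin_power A 2 (us i)))
        = sum_modes A d (\<lambda>i. A.modes_of (\<lambda>l. \<bar>cell_val A (us i) l\<bar>))"
      by (rule A.sum_modes_cong) (use us in \<open>simp add: A.galerkin_root_square\<close>)
    then show "sum_modes A d (\<lambda>i. galerkin_root A 2 (galerkin_power A 2 (us i))) = modes_norm1 A d us"
      by (simp only: A.sum_modes_modes_of A.modes_norm1_eq)
    show "AE \<omega> in M. expansion A (modes_norm1 A d us) (\<xi> \<omega>) = (\<Sum>i=1..d. \<bar>expansion A (us i) (\<xi> \<omega>)\<bar>)"
      unfolding A.modes_norm1_eq
      by (rule AE, rule A.AE_expansion_map[where us = us and N = "\<lambda>v. \<Sum>i=1..d. \<bar>v i\<bar>"]) simp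
  qed
  have c_nonneg: "0 \<le> (\<Sum>i=1..d. rpow \<bar>cell_val A (us i) l\<bar> p)" for p d us l
    by (simp add: sum_nonneg)
  have norm_eq: "modes_norm A p d us = A.modes_of (\<lambda>l. rpow (\<Sum>i=1..d. rpow \<bar>cell_val A (us i) l\<bar> p) (1 / p))"
    if "1 \<le> p" for p d us
    using that by (simp add: A.modes_norm_eq pnorm_def rpow_def)
  have root_c: "galerkin_root A m (galerkin_power A n (modes_c A p d us)) = modes_norm A p d us"
    if "0 < n" "1 \<le> p" "p = real m / real n" for m n p d us
  proof -
    \<comment> \<open>The root of order \<open>m\<close> requires \<open>m > 0\<close>, which
      \<open>m / n = p \<ge> 1\<close> provides; the resulting exponent \<open>n / m\<close> is
      \<open>1 / p\<close>.\<close>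
    have m: "0 < m" using that by (cases m) auto
    show ?thesis
      unfolding A.modes_c_eq A.galerkin_root_power[OF m c_nonneg] norm_eq[OF that(2)]
      using that by simp
  qed
  have root_abs: "galerkin_root A n (galerkin_power A m (modes_abs A u)) = modes_abs_pow A p u"
    if "0 < n" "p = real m / real n" "u \<in> carrier_vec (K + 1)" for m n p u
    unfolding A.modes_abs_eq[OF that(3)] A.modes_abs_pow_eq that(2)
    by (rule A.galerkin_root_power) (use that in auto)
  have power_abs: "galerkin_power A m (modes_abs A u) = modes_abs_pow A (real m) u"
    if "u \<in> carrier_vec (K + 1)" for m u
    unfolding A.modes_abs_eq[OF that] A.modes_abs_pow_eq A.galerkin_power_modes_of
    by (simp add: rpow_realpow)
  have root_c': "galerkin_root A m (modes_c A (real m) d us) = modes_norm A (real m) d us"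
    if "1 \<le> real m" for m d us
    using that unfolding A.modes_c_eq norm_eq[OF that]
    by (intro A.galerkin_root_modes_of c_nonneg) auto
  have norm: "AE \<omega> in M. expansion A (modes_norm A p d us) (\<xi> \<omega>) = pnorm p d (\<lambda>i. expansion A (us i) (\<xi> \<omega>))"
    if "1 \<le> p" for p d us
    unfolding A.modes_norm_eq[OF that]
    by (rule AE, rule A.AE_expansion_map[where us = us and N = "pnorm p d"]) simp
  have jac_abs: "has_jacobian (modes_abs A)
      (haar_H A * diag_fun sgn (haar_D A u) * transpose_mat (haar_H A)) (carrier_vec (K + 1)) u"
    if "u \<in> carrier_vec (K + 1)" "\<forall>l\<le>K. haar_D A u $$ (l, l) \<noteq> 0" for u
    using that unfolding le by (rule A.has_jacobian_modes_abs)
  show ?thesis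
    unfolding modes_abs_def[symmetric]
  proof (intro conjI, goal_cases)
    case 1 show ?case by (rule pow)
  next
    case 2 show ?case
      by (intro allI impI, elim conjE, rule gpc_modes_pow) (auto intro: nonneg)
  next
    case 3 show ?case using sign by blast
  next
    case 4 show ?case using sign_gpc by blast
  next
    case 5 show ?case using abs jac_abs by blast
  next
    case 6 show ?case using gpc_modes_abs by blast
  next
    case 7 show ?case using norm1 by blast
  next
    case 8 show ?case by (intro allI impI gpc_modes_norm1) blast
  next
    case 9 show ?case
    proof (intro allI impI, elim conjE, intro conjI, goal_cases)
      case (1 p d us)
      then show ?case using power_abs root_c' by blast
    next
      case (2 p d us)
      then show ?case using root_abs root_c by blast
    next
      case (3 p d us)
      then show ?case using norm by blast
    next
      case (4 p d us)
      then show ?case unfolding le by (intro ballI impI A.has_jacobian_modes_norm) auto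
    qed
  next
    case 10 show ?case by (intro allI impI, elim conjE, rule gpc_modes_pnorm) blast+
  qed
qed

end
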